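(* Let $t$ be a positive integer and $\mu$ a $t$-core partition. Then for every nonnegative integer $n$, $$\sum_{\substack{\lambda_{t\text{-core}}=\mu\\ |\lambda|-|\mu|=nt}}F_{\lambda/\mu}G_\lambda\sum_{\substack{\square\in\lambda\\ h_\square\equiv 0\ (\mathrm{mod}\ t)}}h_\square^2=nt^2+3t\binom n2.$$
   Context: Partitions are identified with Young diagrams; $h_\square$ is the hook length of a box (boxes to its right in its row, plus below it in its column, plus one), $\mathcal H(\lambda)$ the multiset of hook lengths. A $t$-core is a partition with no hook length divisible by $t$. The 01-sequence $(z_i)_{i\in\mathbb Z}$ of $\lambda$: traverse the boundary of the Young diagram from the bottom (infinite vertical ray below the first column) to the right (infinite horizontal ray right of the first row), labelling vertical edges $0$ and horizontal edges $1$, indexed so that $\#\{i\ge0:z_i=0\}=\#\{i<0:z_i=1\}$. Adding a $t$-hook means exchanging some $z_i=0,z_{i+t}=1$ into $1,0$; removing one is the reverse. $\lambda\ge_t\mu$ means $\lambda$ is obtained from $\mu$ by adding $t$-hooks. The $t$-core $\lambda_{t\text{-core}}$ is obtained by removing $t$-hooks until impossible (independent of choices). $F_{\lambda/\mu}$ (for $\lambda\ge_t\mu$): $F_{\mu/\mu}=1$ and $F_{\lambda/\mu}=\sum F_{\lambda^-/\mu}$ over all $\lambda^-$ with $\lambda\ge_t\lambda^-\ge_t\mu$, $|\lambda|-|\lambda^-|=t$. $G_\lambda=1/\prod_{h\in\mathcal H(\lambda),\,t\mid h}h$. *)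

theory Defs
  imports Complex_Main "HOL-Library.Multiset" "HOL-Library.More_List"
begin

text \<open>A partition is the list of its parts. Rows and columns are numbered from 0, so that row
  \<open>i\<close> of the Young diagram has \<open>nth_default 0 \<rho> i\<close> boxes, for every natural number \<open>i\<close>.\<close>

definition is_partition :: "nat list \<Rightarrow> bool" where
  "is_partition \<rho> \<longleftrightarrow> sorted_wrt (\<ge>) \<rho> \<and> 0 \<notin> set \<rho>"

abbreviation row :: "nat list \<Rightarrow> nat \<Rightarrow> nat" where
  "row \<rho> i \<equiv> nth_default 0 \<rho> i"

definition young_diagram :: "nat list \<Rightarrow> (nat \<times> nat) set" where
  "young_diagram \<rho> = {(i, j). j < row \<rho> i}"

definition hook_length :: "nat list \<Rightarrow> nat \<times> nat \<Rightarrow> nat" where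
  "hook_length \<rho> = (\<lambda>(i, j).
     card {j'. j' > j \<and> (i, j') \<in> young_diagram \<rho>}
     + card {i'. i' > i \<and> (i', j) \<in> young_diagram \<rho>} + 1)"

definition hook_lengths :: "nat list \<Rightarrow> nat multiset" where
  "hook_lengths \<rho> = image_mset (hook_length \<rho>) (mset_set (young_diagram \<rho>))"

definition is_core :: "nat \<Rightarrow> nat list \<Rightarrow> bool" where
  "is_core t \<rho> \<longleftrightarrow> is_partition \<rho> \<and> (\<forall>h \<in># hook_lengths \<rho>. \<not> t dvd h)"

text \<open>The 01-sequence. Let \<open>(x, y)\<close> be the lattice point \<open>x\<close> columns to the right of and \<open>y\<close> rows
  below the upper left corner of the diagram. Along the boundary \<open>x - y\<close> increases by 1 at each
  edge, and the edge starting at \<open>x - y = k\<close> gets the index \<open>k\<close>. The vertical edge at the end of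
  row \<open>i\<close> starts at \<open>(row \<rho> i, i + 1)\<close>. The two lemmas below confirm that the remaining indices
  are those of the horizontal edges (the one below column \<open>j\<close> starts at \<open>(j, y)\<close> where \<open>y\<close> is the
  length of that column) and that this indexing is the balanced one.\<close>

definition seq01 :: "nat list \<Rightarrow> int \<Rightarrow> nat" where
  "seq01 \<rho> k = (if \<exists>i. k = int (row \<rho> i) - int (i + 1) then 0 else 1)"

lemma row_antimono:
  assumes "is_partition \<rho>" "i \<le> i'"
  shows "row \<rho> i' \<le> row \<rho> i"
  using assms unfolding is_partition_def nth_default_def
  by (cases "i = i'") (auto simp: sorted_wrt_iff_nth_less)

lemma row_eq_0: "length \<rho> \<le> i \<Longrightarrow> row \<rho> i = 0"
  by (simp add: nth_default_def)

lemma seq01_horizontal: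
  assumes "is_partition \<rho>"
  shows "seq01 \<rho> k = 1 \<longleftrightarrow> (\<exists>j. k = int j - int (card {i. (i, j) \<in> young_diagram \<rho>}))"
proof -
  have colI: "card {i. (i, j) \<in> young_diagram \<rho>} = m"
    if "row \<rho> m \<le> j" "\<And>i. i < m \<Longrightarrow> j < row \<rho> i" for j m
  proof -
    have "{i. (i, j) \<in> young_diagram \<rho>} = {..<m}"
      using that row_antimono[OF assms, of m] unfolding young_diagram_def
      by (auto simp: not_le[symmetric]) (metis le_trans not_le)
    then show ?thesis by simp
  qed
  show ?thesis
  proof
    assume "seq01 \<rho> k = 1"
    then have nv: "k \<noteq> int (row \<rho> i) - int (i + 1)" for i
      by (auto simp: seq01_def split: if_splits)
    define P where "P i \<longleftrightarrow> int (row \<rho> i) - int (i + 1) < k" for i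
    have "P (length \<rho> + nat \<bar>k\<bar>)" by (simp add: P_def row_eq_0)
    then obtain m where m: "P m" "\<And>i. i < m \<Longrightarrow> \<not> P i"
      using exists_least_iff[of P] by blast
    define j where "j = nat (k + int m)"
    have j: "int j = k + int m" using m(1) by (simp add: j_def P_def)
    have "row \<rho> m \<le> j" using m(1) j by (simp add: P_def)
    moreover have "j < row \<rho> i" if "i < m" for i
    proof -
      have "\<not> P (m - 1)" using m(2) that by simp
      then have "j < row \<rho> (m - 1)" using nv[of "m - 1"] j that by (simp add: P_def)
      also have "\<dots> \<le> row \<rho> i" using row_antimono[OF assms, of i "m - 1"] that by simp
      finally show ?thesis .
    qed
    ultimately have "card {i. (i, j) \<in> young_diagram \<rho>} = m" by (rule colI)
    then show "\<exists>j. k = int j - int (card {i. (i, j) \<in> young_diagram \<rho>})"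
      using j by (intro exI[of _ j]) simp
  next
    assume "\<exists>j. k = int j - int (card {i. (i, j) \<in> young_diagram \<rho>})"
    then obtain j where k: "k = int j - int (card {i. (i, j) \<in> young_diagram \<rho>})" by blast
    have "\<exists>m. row \<rho> m \<le> j" by (rule exI[of _ "length \<rho>"]) (simp add: row_eq_0)
    then obtain m where m: "row \<rho> m \<le> j" "\<And>i. i < m \<Longrightarrow> j < row \<rho> i"
      using exists_least_iff[of "\<lambda>m. row \<rho> m \<le> j"] by (auto simp: not_le)
    have k: "k = int j - int m" using k colI[OF m] by simp
    have "k \<noteq> int (row \<rho> i) - int (i + 1)" for i
      using m(1) m(2)[of i] k row_antimono[OF assms, of m i] by (cases "i < m") auto
    then show "seq01 \<rho> k = 1" by (simp add: seq01_def)
  qed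
qed

lemma seq01_balanced:
  assumes "is_partition \<rho>"
  shows "finite {i. i \<ge> 0 \<and> seq01 \<rho> i = 0}" "finite {i. i < 0 \<and> seq01 \<rho> i = 1}"
    "card {i. i \<ge> 0 \<and> seq01 \<rho> i = 0} = card {i. i < 0 \<and> seq01 \<rho> i = 1}"
proof -
  define N where "N = length \<rho>"
  define b where "b i = int (row \<rho> i) - int (i + 1)" for i
  have b_less: "b i' < b i" if "i < i'" for i i'
    using row_antimono[OF assms, of i i'] that by (simp add: b_def)
  have inj: "inj_on b {..<N}"
    by (rule inj_onI) (metis b_less linorder_neqE_nat order_less_irrefl)
  have z: "seq01 \<rho> k = 0 \<longleftrightarrow> (\<exists>i. k = b i)" for k by (simp add: seq01_def b_def)
  have z1: "seq01 \<rho> k = 1 \<longleftrightarrow> seq01 \<rho> k \<noteq> 0" for k by (simp add: seq01_def)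
  have tail: "b i = - int (i + 1)" if "i \<ge> N" for i
    using that by (simp add: b_def N_def row_eq_0)
  have lb: "b i \<ge> - int N" if "i < N" for i using that by (simp add: b_def)
  define A where "A = {i. i \<ge> 0 \<and> seq01 \<rho> i = 0}"
  define B where "B = {i. i < 0 \<and> seq01 \<rho> i = 1}"
  have split: "b ` {..<N} \<union> B = A \<union> {- int N..<0}"
  proof (intro set_eqI iffI)
    fix k assume "k \<in> b ` {..<N} \<union> B"
    then show "k \<in> A \<union> {- int N..<0}"
    proof
      assume "k \<in> b ` {..<N}"
      then show ?thesis using lb z by (auto simp: A_def)
    next
      assume "k \<in> B"
      then have k: "k < 0" "\<And>i. k \<noteq> b i" using z z1 by (auto simp: B_def)
      have "k \<ge> - int N"
      proof (rule ccontr)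
        assume "\<not> k \<ge> - int N"
        then have "b (nat (- k - 1)) = k" by (subst tail) auto
        with k(2) show False by metis
      qed
      with k(1) show ?thesis by simp
    qed
  next
    fix k assume k: "k \<in> A \<union> {- int N..<0}"
    then have lo: "k \<ge> - int N" by (auto simp: A_def)
    show "k \<in> b ` {..<N} \<union> B"
    proof (cases "\<exists>i. k = b i")
      case True
      then obtain i where i: "k = b i" by blast
      have "i < N" using lo tail[of i] i by (cases "i < N") auto
      with i show ?thesis by blast
    next
      case False
      then show ?thesis using k z z1 by (auto simp: A_def B_def)
    qed
  qed
  have fin: "finite (A \<union> {- int N..<0})" "finite (b ` {..<N} \<union> B)"
  proof -
    have "A \<subseteq> b ` {..<N}"
    proof
      fix k assume "k \<in> A"
      then have k: "k \<ge> 0" "seq01 \<rho> k = 0" by (auto simp: A_def)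
      then obtain i where i: "k = b i" using z by auto
      then have "i < N" using k(1) tail[of i] by (cases "i < N") auto
      with i show "k \<in> b ` {..<N}" by blast
    qed
    then show "finite (A \<union> {- int N..<0})" using finite_subset by blast
    then show "finite (b ` {..<N} \<union> B)" using split by simp
  qed
  then show fA: "finite {i. i \<ge> 0 \<and> seq01 \<rho> i = 0}" and fB: "finite {i. i < 0 \<and> seq01 \<rho> i = 1}"
    by (simp_all add: A_def B_def)
  have "b ` {..<N} \<inter> B = {}" using z z1 by (auto simp: B_def)
  then have "card (b ` {..<N} \<union> B) = N + card B"
    using fB inj by (subst card_Un_disjoint) (auto simp: B_def card_image)
  moreover have "A \<inter> {- int N..<0} = {}" by (auto simp: A_def)
  then have "card (A \<union> {- int N..<0}) = card A + N"
    using fA by (subst card_Un_disjoint) (auto simp: A_def)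
  ultimately have "card A = card B" using split by simp
  then show "card {i. i \<ge> 0 \<and> seq01 \<rho> i = 0} = card {i. i < 0 \<and> seq01 \<rho> i = 1}"
    by (simp add: A_def B_def)
qed

definition adds_hook :: "nat \<Rightarrow> nat list \<Rightarrow> nat list \<Rightarrow> bool" where
  "adds_hook t \<mu> \<rho> \<longleftrightarrow> is_partition \<mu> \<and> is_partition \<rho> \<and>
     (\<exists>i. seq01 \<mu> i = 0 \<and> seq01 \<mu> (i + int t) = 1 \<and>
          seq01 \<rho> = (seq01 \<mu>)(i := 1, i + int t := 0))"

definition hook_ge :: "nat \<Rightarrow> nat list \<Rightarrow> nat list \<Rightarrow> bool" where
  "hook_ge t \<rho> \<mu> \<longleftrightarrow> (adds_hook t)\<^sup>*\<^sup>* \<mu> \<rho>"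

definition core_of :: "nat \<Rightarrow> nat list \<Rightarrow> nat list" where
  "core_of t \<rho> = (THE \<nu>. hook_ge t \<rho> \<nu> \<and> (\<nexists>\<nu>'. adds_hook t \<nu>' \<nu>))"

text \<open>The condition \<open>t > 0\<close> in the sum only serves termination. When \<open>hook_ge t \<rho> \<mu>\<close> fails, the
  sum is empty and the value is 0.\<close>

function skew_F :: "nat \<Rightarrow> nat list \<Rightarrow> nat list \<Rightarrow> nat" where
  "skew_F t \<rho> \<mu> = (if \<rho> = \<mu> then 1
     else \<Sum>\<nu> | t > 0 \<and> hook_ge t \<rho> \<nu> \<and> hook_ge t \<nu> \<mu> \<and> sum_list \<rho> = sum_list \<nu> + t. skew_F t \<nu> \<mu>)"
  by auto
termination
  by (relation "measure (\<lambda>(t, \<rho>, \<mu>). sum_list \<rho>)") auto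

declare skew_F.simps [simp del]

definition hook_G :: "nat \<Rightarrow> nat list \<Rightarrow> real" where
  "hook_G t \<rho> = 1 / real (\<Prod>\<^sub># {#h \<in># hook_lengths \<rho>. t dvd h#})"

lemma finite_young_diagram: "finite (young_diagram \<rho>)"
proof (rule finite_subset)
  show "young_diagram \<rho> \<subseteq> (SIGMA i:{..<length \<rho>}. {..<row \<rho> i})"
    by (auto simp: young_diagram_def nth_default_def split: if_splits)
qed auto

lemma finite_partitions: "finite {\<rho>. is_partition \<rho> \<and> sum_list \<rho> = m}"
proof (rule finite_subset)
  show "{\<rho>. is_partition \<rho> \<and> sum_list \<rho> = m} \<subseteq> {\<rho>. set \<rho> \<subseteq> {..m} \<and> length \<rho> \<le> m}"
  proof safe
    fix \<rho> :: "nat list" and x assume "x \<in> set \<rho>"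
    then show "x \<le> sum_list \<rho>" by (simp add: member_le_sum_list)
  next
    fix \<rho> assume "is_partition \<rho>"
    then have "0 \<notin> set \<rho>" by (simp add: is_partition_def)
    then show "length \<rho> \<le> sum_list \<rho>" by (induction \<rho>) auto
  qed
qed (rule finite_lists_length_le, simp)

end

theory Submission
  imports Defs
begin

text \<open>Boxes of a partition are the pairs \<open>i < j\<close> with \<open>z\<^sub>i = 1\<close> and \<open>z\<^sub>j = 0\<close> in its 01-sequence, and the
  hook length is \<open>j - i\<close>. Hence hook lengths divisible by \<open>t\<close> live inside the residue classes of
  indices modulo \<open>t\<close>, and adding a \<open>t\<close>-hook moves one bead (a \<open>0\<close>) by one step inside one class. In each
  class, the weights \<open>G\<^bsub>\<lambda>\<^esub>\<close> turn the moves into the Plancherel growth process, whose transition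
  probabilities are the residues of a rational function with poles at the beads; their moments of
  order at most 2 follow from a recursion for Lagrange interpolation sums. Summing over the classes,
  the moves from \<open>\<lambda>\<close> with the weights \<open>G\<close> preserve the total mass and increase the sum of the squared
  hook lengths by \<open>t\<^sup>2 + 3tw\<close> on average, where \<open>w\<close> is the number of hook lengths of \<open>\<lambda>\<close> divisible by
  \<open>t\<close>. After \<open>n\<close> steps from a \<open>t\<close>-core \<open>w = n\<close>, and the theorem follows by induction on \<open>n\<close>.\<close>

section \<open>Lagrange interpolation sums\<close>

text \<open>The sum of the residues of \<open>\<Prod>y\<in>Y. (z - y)\<close> divided by \<open>\<Prod>b\<in>B. (z - b)\<close>. Repetitions in \<open>Y\<close> are
  needed: moments about a point \<open>c\<close> are obtained by adding copies of \<open>c\<close> to \<open>Y\<close>.\<close>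

definition lagrange_sum :: "real set \<Rightarrow> real multiset \<Rightarrow> real" where
  "lagrange_sum B Y = (\<Sum>k\<in>B. (\<Prod>y\<in>#Y. k - y) / (\<Prod>j\<in>B - {k}. k - j))"

text \<open>The factor \<open>k - b\<close> kills the term at \<open>b\<close> and cancels the
  factor belonging to \<open>b\<close> in every other denominator, which removes the pole at
  \<open>b\<close>.\<close>

lemma lagrange_sum_factor:
  assumes "finite B" "b \<in> B"
  shows "(\<Sum>k\<in>B. (k - b) * (\<Prod>y\<in>#Y. k - y) / (\<Prod>j\<in>B - {k}. k - j)) = lagrange_sum (B - {b}) Y"
proof -
  have "(\<Sum>k\<in>B. (k - b) * (\<Prod>y\<in>#Y. k - y) / (\<Prod>j\<in>B - {k}. k - j)) =
      (\<Sum>k\<in>B - {b}. (k - b) * (\<Prod>y\<in>#Y. k - y) / (\<Prod>j\<in>B - {k}. k - j))"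
    using assms by (subst sum.remove[of _ b]) auto
  also have "\<dots> = lagrange_sum (B - {b}) Y"
    unfolding lagrange_sum_def
  proof (rule sum.cong)
    fix k assume k: "k \<in> B - {b}"
    have "(\<Prod>j\<in>B - {k}. k - j) = (k - b) * (\<Prod>j\<in>B - {k} - {b}. k - j)"
      using assms k by (subst prod.remove[of _ b]) auto
    moreover have "B - {k} - {b} = B - {b} - {k}" by auto
    ultimately show "(k - b) * (\<Prod>y\<in>#Y. k - y) / (\<Prod>j\<in>B - {k}. k - j) =
        (\<Prod>y\<in>#Y. k - y) / (\<Prod>j\<in>B - {b} - {k}. k - j)"
      using k by simp
  qed simp
  finally show ?thesis .
qed

text \<open>Split \<open>k - y\<close> as \<open>(k - b) + (b - y)\<close>. Both resulting sums have
  the smaller multiset \<open>Y\<close>, so all evaluations below go by induction on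
  \<open>Y\<close>.\<close>

lemma lagrange_sum_add_mset:
  assumes "finite B" "b \<in> B"
  shows "lagrange_sum B (add_mset y Y) = lagrange_sum (B - {b}) Y + (b - y) * lagrange_sum B Y"
proof -
  have "lagrange_sum B (add_mset y Y) =
    (\<Sum>k\<in>B. (k - b) * (\<Prod>y\<in>#Y. k - y) / (\<Prod>j\<in>B - {k}. k - j)) + (b - y) * lagrange_sum B Y"
    unfolding lagrange_sum_def sum_distrib_left sum.distrib[symmetric]
    by (intro sum.cong refl) (simp add: add_divide_distrib[symmetric] algebra_simps)
  then show ?thesis using lagrange_sum_factor[OF assms] by simp
qed

text \<open>Expanding the sum for \<open>{#0#}\<close> at two different points \<open>a\<close> and
  \<open>b\<close> of \<open>B\<close> shows that \<open>b - a\<close> times the sum is a difference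
  of two sums over sets with one point fewer, which agree by induction.\<close>

lemma lagrange_sum_empty_mset:
  assumes "finite B" "B \<noteq> {}"
  shows "lagrange_sum B {#} = (if card B = 1 then 1 else 0)"
  using assms
proof (induction "card B" arbitrary: B rule: less_induct)
  case less
  show ?case
  proof (cases "card B = 1")
    case True
    then obtain b where "B = {b}" by (auto simp: card_1_singleton_iff)
    then show ?thesis by (simp add: lagrange_sum_def)
  next
    case False
    obtain a where a: "a \<in> B" using less.prems by auto
    have "card B \<noteq> 0" using less.prems by simp
    moreover have "card (B - {a}) = card B - 1" using a by simp
    ultimately have "card (B - {a}) \<noteq> 0" using False by linarith
    then obtain b where b: "b \<in> B" "b \<noteq> a" by (metis DiffD1 DiffD2 card.empty equals0I singletonI)
    have "lagrange_sum (B - {a}) {#} - lagrange_sum (B - {b}) {#} = (b - a) * lagrange_sum B {#}"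
      using lagrange_sum_add_mset[OF less.prems(1) a, of 0 "{#}"]
        lagrange_sum_add_mset[OF less.prems(1) b(1), of 0 "{#}"]
      by (simp add: algebra_simps)
    moreover have "lagrange_sum (B - {a}) {#} = lagrange_sum (B - {b}) {#}"
    proof -
      have "card (B - {a}) = card (B - {b})" "card (B - {a}) < card B"
        using a b less.prems by (simp_all add: card_Diff_singleton card_gt_0_iff)
      moreover have "B - {a} \<noteq> {}" "B - {b} \<noteq> {}" using a b by auto
      ultimately show ?thesis using less.hyps[of "B - {a}"] less.hyps[of "B - {b}"] less.prems by simp
    qed
    ultimately show ?thesis using b False by simp
  qed
qed

text \<open>As a sum of all residues, the value is the coefficient of 1/z at infinity. With
  \<open>size Y = card B - 1 + r\<close> it is the complete homogeneous symmetric function of degree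
  \<open>r\<close> in the formal difference of \<open>B\<close> and \<open>Y\<close>. Here
  \<open>r\<close> is at most 0; the next two lemmas treat \<open>r = 1\<close> and
  \<open>r = 2\<close>.\<close>

lemma lagrange_sum_0:
  assumes "finite B" "size Y + 1 \<le> card B"
  shows "lagrange_sum B Y = (if size Y + 1 = card B then 1 else 0)"
  using assms
proof (induction Y arbitrary: B)
  case empty
  then show ?case using lagrange_sum_empty_mset[of B] by force
next
  case (add y Y)
  then obtain b where b: "b \<in> B" by (metis add_is_0 card.empty equals0I le_zero_eq one_neq_zero)
  have "card (B - {b}) = card B - 1" using add.prems b by simp
  then show ?case
    using add.IH[of "B - {b}"] add.IH[of B] add.prems lagrange_sum_add_mset[OF add.prems(1) b, of y Y]
    by auto
qed

lemma lagrange_sum_1: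
  assumes "finite B" "size Y = card B"
  shows "lagrange_sum B Y = \<Sum>B - \<Sum>\<^sub># Y"
  using assms
proof (induction Y arbitrary: B)
  case empty
  then show ?case by (simp add: lagrange_sum_def)
next
  case (add y Y)
  then obtain b where b: "b \<in> B" by fastforce
  have "card (B - {b}) = card B - 1" "\<Sum>B = b + \<Sum>(B - {b})"
    using add.prems b by (simp_all add: sum.remove[of B b])
  then show ?case
    using add.IH[of "B - {b}"] add.prems lagrange_sum_0[of B Y] lagrange_sum_add_mset[OF add.prems(1) b, of y Y]
    by simp
qed

lemma lagrange_sum_2:
  assumes "finite B" "size Y = card B + 1"
  shows "lagrange_sum B Y =
    ((\<Sum>B - \<Sum>\<^sub># Y)\<^sup>2 + ((\<Sum>b\<in>B. b\<^sup>2) - (\<Sum>y\<in>#Y. y\<^sup>2))) / 2"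
  using assms
proof (induction Y arbitrary: B)
  case empty
  then show ?case by simp
next
  case (add y Y)
  show ?case
  proof (cases "B = {}")
    case True
    then have "Y = {#}" using add.prems by simp
    then show ?thesis using True by (simp add: lagrange_sum_def)
  next
    case False
    then obtain b where b: "b \<in> B" by auto
    have B: "card (B - {b}) = card B - 1" "card B > 0" "\<Sum>B = b + \<Sum>(B - {b})"
      "(\<Sum>b\<in>B. b\<^sup>2) = b\<^sup>2 + (\<Sum>b\<in>B - {b}. b\<^sup>2)"
      using add.prems b by (simp_all add: sum.remove[of B b] card_gt_0_iff False)
    have "lagrange_sum (B - {b}) Y = ((\<Sum>(B - {b}) - \<Sum>\<^sub># Y)\<^sup>2 +
        ((\<Sum>b\<in>B - {b}. b\<^sup>2) - (\<Sum>y\<in>#Y. y\<^sup>2))) / 2"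
      using add B by (intro add.IH) auto
    moreover have "lagrange_sum B Y = \<Sum>B - \<Sum>\<^sub># Y"
      using add.prems by (intro lagrange_sum_1) auto
    \<comment> \<open>The recursion as a polynomial identity: \<open>s\<close> and \<open>q\<close>
      stand for the sums of points and of squares over \<open>B - {b}\<close>, \<open>u\<close> and
      \<open>v\<close> for those over \<open>Y\<close>.\<close>
    moreover have alg: "((s - u)\<^sup>2 + (q - v)) / 2 + (b - y) * (b + s - u) =
        ((b + s - (y + u))\<^sup>2 + (b\<^sup>2 + q - (y\<^sup>2 + v))) / 2" for s q u v :: real
      by (simp add: power2_eq_square field_simps)
    ultimately show ?thesis
      by (simp only: lagrange_sum_add_mset[OF add.prems(1) b, of y Y] B(3,4) image_mset_add_mset
          sum_mset.add_mset)
  qed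
qed

section \<open>Bead moves\<close>

definition inversions :: "int set \<Rightarrow> (int \<times> int) set" where
  "inversions M = {(i, j). i \<notin> M \<and> j \<in> M \<and> i < j}"

definition inv_sum :: "(int \<Rightarrow> real) \<Rightarrow> int set \<Rightarrow> real" where
  "inv_sum f M = (\<Sum>(i, j)\<in>inversions M. f (j - i))"

text \<open>Maya diagrams of arbitrary charge: the residue classes of the bead set of a partition
  are of this kind but need not be balanced.\<close>

definition bounded_maya :: "int set \<Rightarrow> bool" where
  "bounded_maya M \<longleftrightarrow> (\<exists>L. {..L} \<subseteq> M) \<and> (\<exists>U. M \<subseteq> {..U})"

abbreviation move :: "int \<Rightarrow> int \<Rightarrow> int set \<Rightarrow> int set" where
  "move k l M \<equiv> insert l (M - {k})"

text \<open>All positions below \<open>L\<close> are occupied, so every inversion lies in the window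
  from \<open>L\<close> on. Writing the empty positions as all positions minus the occupied ones
  splits the sum into a part over single beads and a part over pairs of beads.\<close>

lemma inv_sum_window:
  assumes "{..<L} \<subseteq> M" "M \<subseteq> {..U}"
  defines "B \<equiv> M \<inter> {L..}"
  shows "inv_sum f M = (\<Sum>j\<in>B. \<Sum>i\<in>{L..<j}. f (j - i)) - (\<Sum>j\<in>B. \<Sum>i\<in>{i\<in>B. i < j}. f (j - i))"
proof -
  have "B \<subseteq> {L..U}" using assms by auto
  then have fin: "finite B" by (rule finite_subset) simp
  have below: "L \<le> i" if "i \<notin> M" for i using that assms(1) by (meson lessThan_iff not_le subsetD)
  have inv: "i \<notin> M \<and> j \<in> M \<and> i < j \<longleftrightarrow> j \<in> B \<and> i \<in> {L..<j} - B" for i j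
    using below[of i] by (auto simp: B_def)
  have "inv_sum f M = (\<Sum>(j, i)\<in>(SIGMA j:B. {L..<j} - B). f (j - i))"
    unfolding inv_sum_def inversions_def inv
    by (rule sum.reindex_bij_witness[of _ "\<lambda>(j, i). (i, j)" "\<lambda>(i, j). (j, i)"]) auto
  also have "\<dots> = (\<Sum>j\<in>B. \<Sum>i\<in>{L..<j} - B. f (j - i))"
    using fin by (subst sum.Sigma) auto
  also have "\<dots> = (\<Sum>j\<in>B. (\<Sum>i\<in>{L..<j}. f (j - i)) - (\<Sum>i\<in>{i\<in>B. i < j}. f (j - i)))"
  proof (rule sum.cong)
    fix j assume "j \<in> B"
    have eq: "{L..<j} - B = {L..<j} - {i\<in>B. i < j}" by auto
    have "{i\<in>B. i < j} \<subseteq> {L..<j}" by (auto simp: B_def)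
    then show "(\<Sum>i\<in>{L..<j} - B. f (j - i)) =
        (\<Sum>i\<in>{L..<j}. f (j - i)) - (\<Sum>i\<in>{i\<in>B. i < j}. f (j - i))"
      unfolding eq by (intro sum_diff) simp_all
  qed simp
  finally show ?thesis by (simp add: sum_subtractf)
qed

text \<open>The new point is the upper member of a pair with each smaller point and the lower member
  with each larger one, whence the absolute value.\<close>

lemma pair_sum_insert:
  fixes f :: "int \<Rightarrow> real"
  assumes "finite C" "x \<notin> C"
  shows "(\<Sum>j\<in>insert x C. \<Sum>i\<in>{i\<in>insert x C. i < j}. f (j - i)) =
    (\<Sum>j\<in>C. \<Sum>i\<in>{i\<in>C. i < j}. f (j - i)) + (\<Sum>i\<in>C. f \<bar>x - i\<bar>)"
proof -
  have "(\<Sum>i\<in>{i\<in>insert x C. i < j}. f (j - i)) =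
      (\<Sum>i\<in>{i\<in>C. i < j}. f (j - i)) + (if x < j then f (j - x) else 0)" for j
  proof -
    have "{i\<in>insert x C. i < j} = (if x < j then insert x {i\<in>C. i < j} else {i\<in>C. i < j})" by auto
    then show ?thesis using assms by simp
  qed
  then have "(\<Sum>j\<in>insert x C. \<Sum>i\<in>{i\<in>insert x C. i < j}. f (j - i)) =
      (\<Sum>j\<in>C. \<Sum>i\<in>{i\<in>C. i < j}. f (j - i)) + ((\<Sum>i\<in>{i\<in>C. i < x}. f (x - i)) +
       (\<Sum>j\<in>C. if x < j then f (j - x) else 0))"
    using assms by (simp add: sum.distrib)
  also have "(\<Sum>i\<in>{i\<in>C. i < x}. f (x - i)) = (\<Sum>j\<in>C. if j < x then f (x - j) else 0)"
    using assms(1) by (simp add: sum.inter_filter)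
  also have "\<dots> + (\<Sum>j\<in>C. if x < j then f (j - x) else 0) = (\<Sum>i\<in>C. f \<bar>x - i\<bar>)"
    unfolding sum.distrib[symmetric] by (intro sum.cong) (use assms in auto)
  finally show ?thesis .
qed

text \<open>In the window formula only the single-bead term of the moved bead and its pair terms
  with the other beads change.\<close>

lemma inv_sum_move:
  assumes "{..<L} \<subseteq> M" "M \<subseteq> {..U}" "k \<in> M" "k + 1 \<notin> M" "L \<le> k"
  defines "B \<equiv> M \<inter> {L..}"
  shows "inv_sum f (move k (k + 1) M) =
    inv_sum f M + f (k + 1 - L) - (\<Sum>j\<in>B - {k}. f \<bar>k + 1 - j\<bar> - f \<bar>k - j\<bar>)"
proof -
  define C where "C = B - {k}"
  have "B \<subseteq> {L..U}" using assms by auto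
  then have "finite B" by (rule finite_subset) simp
  then have fin: "finite C" by (simp add: C_def)
  have B: "B = insert k C" "k \<notin> C" "k + 1 \<notin> C" and BC: "B - {k} = C" using assms by (auto simp: C_def)
  have B': "move k (k + 1) M \<inter> {L..} = insert (k + 1) C" using assms by (auto simp: C_def)
  define V where "V j = (\<Sum>i\<in>{L..<j}. f (j - i))" for j
  have 1: "inv_sum f M = (\<Sum>j\<in>B. V j) - (\<Sum>j\<in>B. \<Sum>i\<in>{i\<in>B. i < j}. f (j - i))"
    unfolding V_def B_def by (rule inv_sum_window) (use assms in auto)
  have 2: "inv_sum f (move k (k + 1) M) = (\<Sum>j\<in>insert (k + 1) C. V j) -
      (\<Sum>j\<in>insert (k + 1) C. \<Sum>i\<in>{i\<in>insert (k + 1) C. i < j}. f (j - i))"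
    unfolding V_def B'[symmetric]
    by (rule inv_sum_window[where U = "max U (k + 1)"]) (use assms in \<open>auto simp: max_def\<close>)
  \<comment> \<open>Moving the bead and the other end of each distance together reproduces
    \<open>V k\<close>; only the distance to \<open>L\<close> is new.\<close>
  have "V (k + 1) = f (k + 1 - L) + (\<Sum>i\<in>{L + 1..<k + 1}. f (k + 1 - i))"
  proof -
    have "{L..<k + 1} = insert L {L + 1..<k + 1}" using assms(5) by auto
    then show ?thesis by (simp add: V_def)
  qed
  also have "(\<Sum>i\<in>{L + 1..<k + 1}. f (k + 1 - i)) = V k"
    unfolding V_def by (rule sum.reindex_bij_witness[of _ "\<lambda>i. i + 1" "\<lambda>i. i - 1"]) (auto simp: algebra_simps)
  finally have V: "V (k + 1) = f (k + 1 - L) + V k" .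
  show ?thesis
    unfolding 1 2 BC unfolding B(1) pair_sum_insert[OF fin B(2)] pair_sum_insert[OF fin B(3)]
    using fin B(2,3) V by (simp add: sum_subtractf)
qed

section \<open>Moments of a single bead step\<close>

definition addable :: "int \<Rightarrow> int set \<Rightarrow> int set" where
  "addable s M = {k \<in> M. k + s \<notin> M}"

lemma pair_sum_1:
  fixes C :: "int set"
  assumes "finite C"
  shows "(\<Sum>j\<in>C. \<Sum>i\<in>{i\<in>C. i < j}. 1 :: real) = real (card C) * (real (card C) - 1) / 2"
  using assms
proof (induction C rule: finite_induct)
  case (insert x C)
  then show ?case
    using pair_sum_insert[of C x "\<lambda>_. 1"] by (simp add: field_simps)
qed simp

lemma lagrange_sum_of_int:
  "lagrange_sum (real_of_int ` B) Y =
    (\<Sum>k\<in>B. (\<Prod>y\<in>#Y. of_int k - y) / (\<Prod>j\<in>B - {k}. of_int k - of_int j))"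
proof -
  have "(\<Prod>j\<in>real_of_int ` B - {of_int k}. of_int k - j) = (\<Prod>j\<in>B - {k}. real_of_int k - of_int j)" for k
  proof -
    have "real_of_int ` B - {of_int k} = real_of_int ` (B - {k})" by auto
    then show ?thesis by (simp add: prod.reindex inj_on_def)
  qed
  then show ?thesis unfolding lagrange_sum_def by (simp add: sum.reindex inj_on_def)
qed

text \<open>The exponential turns the pair terms into quotients of \<open>k + 1 - j\<close> by
  \<open>k - j\<close>, so that, up to the factor \<open>1 / t\<close>, the weight is the residue at
  \<open>k\<close> of a rational function with poles at the beads and zeros one step below them. The
  single-bead term cancels the zero belonging to \<open>L\<close>, which leaves one zero fewer than
  poles.\<close>

lemma exp_inv_sum_ln_move:
  fixes t :: real
  assumes "{..<L} \<subseteq> M" "M \<subseteq> {..U}" "L \<in> M" "L + 1 \<in> M" "k \<in> addable 1 M" "t > 0"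
  defines "B \<equiv> M \<inter> {L..}" and "f \<equiv> \<lambda>x. ln (t * of_int x)"
  shows "exp (inv_sum f M - inv_sum f (move k (k + 1) M)) =
    (\<Prod>j\<in>B - {L}. real_of_int k - (of_int j - 1)) / (\<Prod>j\<in>B - {k}. of_int k - of_int j) / t"
proof -
  have k: "k \<in> M" "k + 1 \<notin> M" using assms(5) by (auto simp: addable_def)
  have "k > L"
  proof (rule ccontr)
    assume "\<not> k > L"
    then have "k + 1 < L \<or> k + 1 = L \<or> k + 1 = L + 1" by auto
    then show False using assms(1,3,4) k(2) by auto
  qed
  then have kB: "k \<in> B" "L \<in> B - {k}" using k assms by (auto simp: B_def)
  have "B \<subseteq> {L..U}" using assms by auto
  then have fin: "finite B" by (rule finite_subset) simp
  \<comment> \<open>As neither \<open>k\<close> nor \<open>k + 1\<close> equals \<open>j\<close>,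
    both differences have the same sign and the absolute values disappear in the quotient, as does
    \<open>t\<close>.\<close>
  have ratio: "exp (f \<bar>k + 1 - j\<bar> - f \<bar>k - j\<bar>) = (real_of_int k - (of_int j - 1)) / (of_int k - of_int j)"
    if "j \<in> B - {k}" for j
  proof -
    have j: "j \<noteq> k" "j \<noteq> k + 1" using that k by (auto simp: B_def)
    then have "exp (f \<bar>k + 1 - j\<bar> - f \<bar>k - j\<bar>) =
        real_of_int \<bar>k + 1 - j\<bar> / real_of_int \<bar>k - j\<bar>"
      using assms(6) by (simp add: f_def exp_diff)
    also have "\<dots> = (real_of_int k - (of_int j - 1)) / (of_int k - of_int j)"
    proof (cases "j < k")
      case False
      then have "k + 1 - j < 0" "k - j < 0" using j by auto
      then have "\<bar>k + 1 - j\<bar> = - (k + 1 - j)" "\<bar>k - j\<bar> = - (k - j)" by linarith+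
      then have "real_of_int \<bar>k + 1 - j\<bar> / real_of_int \<bar>k - j\<bar> =
        - real_of_int (k + 1 - j) / - real_of_int (k - j)" by (simp only: of_int_minus)
      then show ?thesis by (simp only: minus_divide_divide) (simp add: algebra_simps)
    qed (simp add: algebra_simps)
    finally show ?thesis .
  qed
  have "inv_sum f M - inv_sum f (move k (k + 1) M) =
      (\<Sum>j\<in>B - {k}. f \<bar>k + 1 - j\<bar> - f \<bar>k - j\<bar>) - f (k + 1 - L)"
    using inv_sum_move[OF assms(1,2) k, of f] \<open>k > L\<close> by (simp add: B_def)
  then have "exp (inv_sum f M - inv_sum f (move k (k + 1) M)) =
      (\<Prod>j\<in>B - {k}. exp (f \<bar>k + 1 - j\<bar> - f \<bar>k - j\<bar>)) / exp (f (k + 1 - L))"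
    using fin by (simp add: exp_diff exp_sum)
  also have "exp (f (k + 1 - L)) = t * (real_of_int k - (of_int L - 1))"
  proof -
    have "t * real_of_int (k + 1 - L) > 0" using \<open>k > L\<close> assms(6) by simp
    then have "exp (f (k + 1 - L)) = t * real_of_int (k + 1 - L)" unfolding f_def by (rule exp_ln)
    then show ?thesis by simp
  qed
  also have "(\<Prod>j\<in>B - {k}. exp (f \<bar>k + 1 - j\<bar> - f \<bar>k - j\<bar>)) =
      (\<Prod>j\<in>B - {k}. real_of_int k - (of_int j - 1)) / (\<Prod>j\<in>B - {k}. of_int k - of_int j)"
    by (subst prod_dividef[symmetric]) (intro prod.cong refl ratio)
  \<comment> \<open>The factor added for \<open>j = k\<close> is
    \<open>k - (k - 1) = 1\<close>.\<close>
  also have "(\<Prod>j\<in>B - {k}. real_of_int k - (of_int j - 1)) =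
      (\<Prod>j\<in>B. real_of_int k - (of_int j - 1))"
    using fin kB by (subst prod.remove[of B k]) auto
  also have "\<dots> = (real_of_int k - (of_int L - 1)) * (\<Prod>j\<in>B - {L}. real_of_int k - (of_int j - 1))"
    using fin kB by (subst prod.remove[of B L]) auto
  finally have "exp (inv_sum f M - inv_sum f (move k (k + 1) M)) = u * N / D / (t * u)"
    if "u = real_of_int k - (of_int L - 1)" and "N = (\<Prod>j\<in>B - {L}. real_of_int k - (of_int j - 1))"
      and "D = (\<Prod>j\<in>B - {k}. real_of_int k - of_int j)" for u N D
    using that by (simp only:)
  moreover have "real_of_int k - (of_int L - 1) \<noteq> 0" using \<open>k > L\<close> by simp
  ultimately show ?thesis by simp
qed

lemma inv_sum_1_window:
  assumes "{..<L} \<subseteq> M" "M \<subseteq> {..U}"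
  defines "B \<equiv> M \<inter> {L..}"
  shows "inv_sum (\<lambda>_. 1) M = (\<Sum>j\<in>B. real_of_int j - of_int L) - real (card B) * (real (card B) - 1) / 2"
proof -
  have "B \<subseteq> {L..U}" using assms by auto
  then have fin: "finite B" by (rule finite_subset) simp
  have "inv_sum (\<lambda>_. 1) M = (\<Sum>j\<in>B. \<Sum>i\<in>{L..<j}. 1) - (\<Sum>j\<in>B. \<Sum>i\<in>{i\<in>B. i < j}. 1)"
    unfolding B_def by (rule inv_sum_window) (use assms in auto)
  also have "(\<Sum>j\<in>B. \<Sum>i\<in>{L..<j}. 1 :: real) = (\<Sum>j\<in>B. real_of_int j - of_int L)"
    by (intro sum.cong) (auto simp: B_def)
  finally show ?thesis using pair_sum_1[OF fin] by simp
qed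

text \<open>Each pair term is a difference of consecutive squares, hence linear in \<open>k\<close>.
  The whole change is quadratic in \<open>k\<close>, and its mean needs only moments of order at
  most 2.\<close>

lemma inv_sum_square_move:
  fixes t :: real
  assumes "{..<L} \<subseteq> M" "M \<subseteq> {..U}" "L \<le> k" "k \<in> addable 1 M"
  defines "B \<equiv> M \<inter> {L..}" and "f \<equiv> \<lambda>x. (t * of_int x)\<^sup>2"
  shows "inv_sum f (move k (k + 1) M) - inv_sum f M =
    t\<^sup>2 * ((real_of_int k - (of_int L - 1))\<^sup>2 - 2 * real (card B) * of_int k +
      2 * (\<Sum>j\<in>B. of_int j) - real (card B) + 1)"
proof -
  have k: "k \<in> M" "k + 1 \<notin> M" using assms(4) by (auto simp: addable_def)
  have "B \<subseteq> {L..U}" using assms by auto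
  then have fin: "finite B" by (rule finite_subset) simp
  have kB: "k \<in> B" using k assms by (auto simp: B_def)
  have "(\<Sum>j\<in>B - {k}. f \<bar>k + 1 - j\<bar> - f \<bar>k - j\<bar>) =
    (\<Sum>j\<in>B - {k}. t\<^sup>2 * (2 * (of_int k - of_int j) + 1))"
    by (intro sum.cong refl) (auto simp: f_def power_mult_distrib power2_eq_square algebra_simps)
  also have "\<dots> = (\<Sum>j\<in>B. t\<^sup>2 * (2 * (of_int k - of_int j) + 1)) - t\<^sup>2"
    using fin kB by (simp add: sum.remove[of B k])
  also have "\<dots> = t\<^sup>2 * (2 * real (card B) * of_int k - 2 * (\<Sum>j\<in>B. of_int j) + real (card B) - 1)"
    unfolding sum_distrib_left[symmetric] sum.distrib sum_subtractf by (simp add: algebra_simps)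
  finally have "(\<Sum>j\<in>B - {k}. f \<bar>k + 1 - j\<bar> - f \<bar>k - j\<bar>) = \<dots>" .
  moreover have "f (k + 1 - L) = t\<^sup>2 * (real_of_int k - (of_int L - 1))\<^sup>2"
    by (simp add: f_def power_mult_distrib algebra_simps)
  ultimately show ?thesis
    using inv_sum_move[OF assms(1,2) k assms(3), of f] by (simp add: B_def algebra_simps)
qed

text \<open>Products over inversions are written as exponentials of sums of logarithms, so that one lemma on
  the change of \<open>inv_sum\<close> covers the hook product, the sum of squares and the number of hooks. The
  scale \<open>t\<close> is the ratio between positions in a residue class modulo \<open>t\<close> and positions on the
  original line.\<close>

lemma plancherel_moments:
  fixes t :: real and M :: "int set"
  assumes "bounded_maya M" "t > 0"
  defines "p \<equiv> \<lambda>k. exp (inv_sum (\<lambda>x. ln (t * of_int x)) M - inv_sum (\<lambda>x. ln (t * of_int x)) (move k (k + 1) M))"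
    and "d \<equiv> \<lambda>k. inv_sum (\<lambda>x. (t * of_int x)\<^sup>2) (move k (k + 1) M) - inv_sum (\<lambda>x. (t * of_int x)\<^sup>2) M"
  shows "finite (addable 1 M)" "(\<Sum>k\<in>addable 1 M. p k) = 1 / t"
    "(\<Sum>k\<in>addable 1 M. p k * d k) = t * (3 * inv_sum (\<lambda>_. 1) M + 1)"
proof -
  obtain L0 U where L0: "{..L0} \<subseteq> M" and U: "M \<subseteq> {..U}"
    using assms(1) by (auto simp: bounded_maya_def)
  \<comment> \<open>With \<open>L\<close> and \<open>L + 1\<close> both in \<open>M\<close>, no bead at \<open>L\<close> can move.\<close>
  define L where "L = L0 - 1"
  have L: "{..<L} \<subseteq> M" "L \<in> M" "L + 1 \<in> M" using L0 by (auto simp: L_def)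
  define B where "B = M \<inter> {L..}"
  have "B \<subseteq> {L..U}" using U by (auto simp: B_def)
  then have fin: "finite B" by (rule finite_subset) simp
  have LB: "L \<in> B" using L by (simp add: B_def)
  have sub: "addable 1 M \<subseteq> B"
  proof
    fix k assume "k \<in> addable 1 M"
    then have k: "k \<in> M" "k + 1 \<notin> M" by (auto simp: addable_def)
    then have "k + 1 \<notin> {..L0}" using L0 by blast
    then have "\<not> k < L" by (simp add: L_def)
    then show "k \<in> B" using k by (simp add: B_def)
  qed
  then show "finite (addable 1 M)" using fin finite_subset by blast
  define m where "m = real (card B)"
  define s where "s = (\<Sum>j\<in>B. real_of_int j)"
  \<comment> \<open>\<open>c\<close> is the zero belonging to \<open>L\<close>, the one missing from
    the zeros \<open>Y\<close> defined next. The moments are taken about \<open>c\<close>, since the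
    square in the change \<open>d k\<close> is centred there.\<close>
  define c where "c = real_of_int L - 1"
  define Y where "Y = image_mset (\<lambda>j. real_of_int j - 1) (mset_set (B - {L}))"
  define q where "q k = (\<Prod>j\<in>B - {L}. real_of_int k - (of_int j - 1)) / (\<Prod>j\<in>B - {k}. of_int k - of_int j)" for k
  have prodY: "(\<Prod>y\<in>#Y. x - y) = (\<Prod>j\<in>B - {L}. x - (of_int j - 1))" for x
    unfolding Y_def by (simp add: prod_unfold_prod_mset image_mset.compositionality comp_def)
  have sumY: "(\<Sum>y\<in>#Y. g y) = (\<Sum>j\<in>B. g (of_int j - 1)) - g c" for g :: "real \<Rightarrow> real"
    using fin LB unfolding Y_def c_def
    by (simp add: sum_unfold_sum_mset[symmetric] image_mset.compositionality comp_def sum.remove[of B L])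
  have "card B \<noteq> 0" using fin LB by auto
  moreover have "size Y = card B - 1" using LB by (simp add: Y_def)
  ultimately have size: "size Y + 1 = card B" by linarith
  define R where "R = real_of_int ` B"
  have R: "finite R" "card R = card B" using fin by (auto simp: R_def card_image inj_on_def)
  have sumR: "(\<Sum>x\<in>R. g x) = (\<Sum>j\<in>B. g (of_int j))" for g :: "real \<Rightarrow> real"
    by (simp add: R_def sum.reindex inj_on_def)
  have sY: "\<Sum>\<^sub># Y = s - m - c"
    using sumY[of "\<lambda>x. x"] by (simp add: sum_subtractf s_def m_def)
  have sY2: "(\<Sum>y\<in>#Y. y\<^sup>2) = (\<Sum>j\<in>B. (real_of_int j)\<^sup>2) - 2 * s + m - c\<^sup>2"
    using sumY[of "\<lambda>x. x\<^sup>2"]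
    by (simp add: sum_subtractf s_def m_def power2_diff sum.distrib sum_distrib_left)
  have sR: "\<Sum>R = s" "(\<Sum>x\<in>R. x\<^sup>2) = (\<Sum>j\<in>B. (real_of_int j)\<^sup>2)"
    using sumR[of "\<lambda>x. x"] sumR[of "\<lambda>x. x\<^sup>2"] by (simp_all add: s_def)
  have E0: "(\<Sum>k\<in>B. q k) = 1"
    using lagrange_sum_0[of R Y] R size
    by (simp add: R_def lagrange_sum_of_int prodY q_def)
  have E1: "(\<Sum>k\<in>B. q k * (of_int k - c)) = m"
  proof -
    have "lagrange_sum R (add_mset c Y) = m"
      using lagrange_sum_1[of R "add_mset c Y"] R size by (simp add: sR sY)
    then show ?thesis by (simp add: R_def lagrange_sum_of_int prodY q_def mult.commute)
  qed
  have E2: "(\<Sum>k\<in>B. q k * (of_int k - c)\<^sup>2) = (m\<^sup>2 - 2 * m * c + 2 * s - m) / 2"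
  proof -
    \<comment> \<open>Two copies of \<open>c\<close> bring the multiset to size
      \<open>card B + 1\<close>. The sum \<open>e\<close> of the squared bead positions then
      cancels.\<close>
    define e where "e = (\<Sum>j\<in>B. (real_of_int j)\<^sup>2)"
    have "lagrange_sum R (add_mset c (add_mset c Y)) =
        ((s - (s - m - c + 2 * c))\<^sup>2 + (e - (e - 2 * s + m - c\<^sup>2 + 2 * c\<^sup>2))) / 2"
      using lagrange_sum_2[of R "add_mset c (add_mset c Y)"] R size
      by (simp add: sR sY sY2 e_def)
    also have "\<dots> = (m\<^sup>2 - 2 * m * c + 2 * s - m) / 2"
      by (simp add: power2_eq_square algebra_simps)
    finally have "lagrange_sum R (add_mset c (add_mset c Y)) = (m\<^sup>2 - 2 * m * c + 2 * s - m) / 2" .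
    then show ?thesis
      by (simp add: R_def lagrange_sum_of_int prodY q_def power2_eq_square mult_ac)
  qed
  \<comment> \<open>Beads that cannot move drop out: their weight contains the factor \<open>k - ((k + 1) - 1)\<close>.\<close>
  have q0: "q k = 0" if "k \<in> B - addable 1 M" for k
  proof -
    have "k + 1 \<in> B - {L}" using that by (auto simp: B_def addable_def)
    then have "(\<Prod>j\<in>B - {L}. real_of_int k - (of_int j - 1)) = 0"
      using fin by (intro prod_zero) (auto intro!: bexI[of _ "k + 1"])
    then show ?thesis by (simp add: q_def)
  qed
  have restrict: "(\<Sum>k\<in>addable 1 M. q k * g k) = (\<Sum>k\<in>B. q k * g k)" for g
    by (rule sum.mono_neutral_left) (use fin sub q0 in auto)
  have p: "p k = q k / t" if "k \<in> addable 1 M" for k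
    unfolding p_def q_def B_def by (rule exp_inv_sum_ln_move[OF L(1) U L(2,3) that assms(2)])
  have "(\<Sum>k\<in>addable 1 M. p k) = (\<Sum>k\<in>addable 1 M. q k * (1 / t))"
    by (intro sum.cong) (auto simp: p)
  then show "(\<Sum>k\<in>addable 1 M. p k) = 1 / t"
    using E0 by (simp only: restrict) (simp add: sum_divide_distrib[symmetric])
  have "(\<Sum>k\<in>addable 1 M. p k * d k) =
      (\<Sum>k\<in>addable 1 M. q k * (t * ((of_int k - c)\<^sup>2 - 2 * m * of_int k + 2 * s - m + 1)))"
  proof (intro sum.cong refl)
    fix k assume k: "k \<in> addable 1 M"
    have "d k = t\<^sup>2 * ((of_int k - c)\<^sup>2 - 2 * m * of_int k + 2 * s - m + 1)"
      unfolding d_def c_def m_def s_def B_def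
      by (rule inv_sum_square_move[OF L(1) U _ k]) (use k sub in \<open>auto simp: B_def\<close>)
    then show "p k * d k = q k * (t * ((of_int k - c)\<^sup>2 - 2 * m * of_int k + 2 * s - m + 1))"
      using p[OF k] assms(2) by (simp add: power2_eq_square)
  qed
  \<comment> \<open>Expand the linear term about \<open>c\<close>, so that only the three moments
    \<open>E0\<close>, \<open>E1\<close> and \<open>E2\<close> occur.\<close>
  also have "\<dots> = t * (\<Sum>k\<in>B. q k * (of_int k - c)\<^sup>2 - 2 * m * (q k * (of_int k - c)) +
      (2 * s - m + 1 - 2 * m * c) * q k)"
    unfolding restrict sum_distrib_left by (intro sum.cong refl) (simp add: algebra_simps)
  also have "\<dots> = t * ((m\<^sup>2 - 2 * m * c + 2 * s - m) / 2 - 2 * m * m + (2 * s - m + 1 - 2 * m * c))"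
    unfolding sum.distrib sum_subtractf sum_distrib_left[symmetric] E0 E1 E2 by simp
  also have "\<dots> = t * (3 * (s - m * (c + 1) - m * (m - 1) / 2) + 1)"
    by (simp add: power2_eq_square field_simps)
  \<comment> \<open>Since \<open>c + 1 = L\<close>, this is the window formula for the number of
    inversions.\<close>
  also have "s - m * (c + 1) - m * (m - 1) / 2 = inv_sum (\<lambda>_. 1) M"
    using inv_sum_1_window[OF L(1) U]
    by (simp add: B_def[symmetric] s_def m_def c_def sum_subtractf)
  finally show "(\<Sum>k\<in>addable 1 M. p k * d k) = t * (3 * inv_sum (\<lambda>_. 1) M + 1)" .
qed

lemma inv_sum_1_move:
  assumes "bounded_maya M" "k \<in> addable 1 M"
  shows "inv_sum (\<lambda>_. 1) (move k (k + 1) M) = inv_sum (\<lambda>_. 1) M + 1"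
proof -
  obtain L U where L: "{..L} \<subseteq> M" and U: "M \<subseteq> {..U}"
    using assms(1) by (auto simp: bounded_maya_def)
  have k: "k \<in> M" "k + 1 \<notin> M" using assms(2) by (auto simp: addable_def)
  then have "k + 1 \<notin> {..L}" using L by blast
  then have "L \<le> k" by simp
  moreover have "{..<L} \<subseteq> M" using L by auto
  ultimately show ?thesis using inv_sum_move[OF _ U k, of L "\<lambda>_. 1"] by simp
qed

section \<open>Residue classes\<close>

lemma finite_inversions:
  assumes "bounded_maya M"
  shows "finite (inversions M)"
proof -
  obtain L U where L: "{..L} \<subseteq> M" and U: "M \<subseteq> {..U}"
    using assms by (auto simp: bounded_maya_def)
  have "inversions M \<subseteq> {L..U} \<times> {L..U}"
  proof
    fix x assume "x \<in> inversions M"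
    then obtain i j where x: "x = (i, j)" "i \<notin> M" "j \<in> M" "i < j" by (auto simp: inversions_def)
    then have "i \<notin> {..L}" "j \<in> {..U}" using L U by blast+
    then show "x \<in> {L..U} \<times> {L..U}" using x by auto
  qed
  then show ?thesis by (rule finite_subset) simp
qed

lemma bounded_maya_move:
  assumes "bounded_maya M"
  shows "bounded_maya (move k l M)"
proof -
  obtain L U where L: "{..L} \<subseteq> M" and U: "M \<subseteq> {..U}"
    using assms by (auto simp: bounded_maya_def)
  have "{..min L (k - 1)} \<subseteq> move k l M" using L by auto
  moreover have "move k l M \<subseteq> {..max U l}" using U by auto
  ultimately show ?thesis unfolding bounded_maya_def by blast
qed

text \<open>The runners of the abacus with \<open>t\<close> runners, rescaled so that neighbouring
  positions on a runner differ by 1.\<close>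

definition residue :: "nat \<Rightarrow> int set \<Rightarrow> int \<Rightarrow> int set" where
  "residue t Z r = {q. int t * q + r \<in> Z}"

definition inv_sum_mod :: "nat \<Rightarrow> (int \<Rightarrow> real) \<Rightarrow> int set \<Rightarrow> real" where
  "inv_sum_mod t f Z = (\<Sum>(i, j) | (i, j) \<in> inversions Z \<and> int t dvd j - i. f (j - i))"

lemma bounded_maya_residue:
  assumes "bounded_maya Z" "t > 0"
  shows "bounded_maya (residue t Z r)"
proof -
  obtain L U where L: "{..L} \<subseteq> Z" and U: "Z \<subseteq> {..U}"
    using assms by (auto simp: bounded_maya_def)
  have t: "int t \<ge> 1" using assms by simp
  \<comment> \<open>The absolute value forces \<open>q\<close> to be nonpositive, so that
    multiplying \<open>q\<close> by \<open>t\<close> can only lower it.\<close>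
  have "{..- \<bar>L - r\<bar>} \<subseteq> residue t Z r"
  proof
    fix q assume "q \<in> {..- \<bar>L - r\<bar>}"
    then have q: "q \<le> 0" "q \<le> L - r" by auto
    then have "int t * q \<le> 1 * q" using t by (intro mult_right_mono_neg) auto
    then have "int t * q + r \<in> {..L}" using q by simp
    then show "q \<in> residue t Z r" using L by (auto simp: residue_def)
  qed
  moreover have "residue t Z r \<subseteq> {..\<bar>U - r\<bar>}"
  proof
    fix q assume "q \<in> residue t Z r"
    then have q: "int t * q + r \<le> U" using U by (auto simp: residue_def)
    have "q \<le> \<bar>U - r\<bar>"
    proof (rule ccontr)
      assume n: "\<not> q \<le> \<bar>U - r\<bar>"
      then have "1 * q \<le> int t * q" using t by (intro mult_right_mono) auto
      then show False using n q by simp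
    qed
    then show "q \<in> {..\<bar>U - r\<bar>}" by simp
  qed
  ultimately show ?thesis unfolding bounded_maya_def by blast
qed

text \<open>Two positions differ by a multiple of \<open>t\<close> exactly when they lie on the same
  runner, and their distance is then \<open>t\<close> times the distance on the runner.\<close>

lemma inv_sum_mod_residue:
  assumes "bounded_maya Z" "t > 0"
  shows "inv_sum_mod t f Z = (\<Sum>r\<in>{0..<int t}. inv_sum (\<lambda>x. f (int t * x)) (residue t Z r))"
proof -
  have "(\<Sum>r\<in>{0..<int t}. inv_sum (\<lambda>x. f (int t * x)) (residue t Z r)) =
      (\<Sum>(r, a, b)\<in>(SIGMA r:{0..<int t}. inversions (residue t Z r)). f (int t * (b - a)))"
    unfolding inv_sum_def using assms
    by (subst sum.Sigma) (auto intro!: finite_inversions bounded_maya_residue simp: split_beta)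
  also have "\<dots> = inv_sum_mod t f Z"
    unfolding inv_sum_mod_def
  proof (rule sum.reindex_bij_witness[of _
        "\<lambda>(i, j). (i mod int t, i div int t, j div int t)"
        "\<lambda>(r, a, b). (int t * a + r, int t * b + r)"], goal_cases)
    case (1 x)
    then show ?case using assms(2) by (auto simp: split_beta)
  next
    case (2 x)
    then show ?case using assms(2) by (auto simp: residue_def inversions_def algebra_simps)
  next
    case (3 x)
    then obtain i j where x: "x = (i, j)" "(i, j) \<in> inversions Z" "int t dvd j - i" by auto
    then have "j mod int t = i mod int t" by (simp add: mod_eq_dvd_iff)
    then have j: "int t * (j div int t) + i mod int t = j" by (metis mult_div_mod_eq)
    then show ?case using x by simp
  next
    case (4 x)
    then obtain i j where x: "x = (i, j)" "(i, j) \<in> inversions Z" "int t dvd j - i" by auto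
    then have m: "j mod int t = i mod int t" by (simp add: mod_eq_dvd_iff)
    then have j: "int t * (j div int t) + i mod int t = j" by (metis mult_div_mod_eq)
    have "i div int t < j div int t"
    proof (rule ccontr)
      assume "\<not> i div int t < j div int t"
      then have "int t * (j div int t) \<le> int t * (i div int t)" by (intro mult_left_mono) auto
      then have "j \<le> i" using j mult_div_mod_eq[of "int t" i] by linarith
      then show False using x by (simp add: inversions_def)
    qed
    then show ?case using x j assms(2) by (simp add: inversions_def residue_def)
  next
    case (5 x)
    then show ?case by (auto simp: algebra_simps)
  qed
  finally show ?thesis by simp
qed

lemma int_mod_unique:
  assumes "int t * q + r = int t * q' + r'" "r \<in> {0..<int t}" "r' \<in> {0..<int t}"
  shows "q = q' \<and> r = r'"
proof -
  have "(int t * q + r) mod int t = r" "(int t * q' + r') mod int t = r'" using assms(2,3) by simp_all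
  then have "r = r'" unfolding assms(1) by simp
  moreover from this have "int t * q = int t * q'" using assms(1) by simp
  moreover have "int t \<noteq> 0" using assms(2) by auto
  ultimately show ?thesis by simp
qed

lemma residue_move:
  assumes "r \<in> {0..<int t}" "r' \<in> {0..<int t}"
  shows "residue t (move (int t * q + r) (int t * q + r + int t) Z) r' =
    (if r' = r then move q (q + 1) (residue t Z r) else residue t Z r')"
proof -
  have "int t * x + r' = int t * q + r \<longleftrightarrow> x = q \<and> r' = r" for x
    using int_mod_unique[OF _ assms(2,1)] by auto
  moreover have "int t * x + r' = int t * q + r + int t \<longleftrightarrow> x = q + 1 \<and> r' = r" for x
    using int_mod_unique[OF _ assms(2,1), of x "q + 1"] by (auto simp: algebra_simps)
  ultimately show ?thesis by (auto simp: residue_def)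
qed

lemma inv_sum_mod_move:
  assumes "bounded_maya Z" "t > 0" "r \<in> {0..<int t}"
  shows "inv_sum_mod t f (move (int t * q + r) (int t * q + r + int t) Z) - inv_sum_mod t f Z =
    inv_sum (\<lambda>x. f (int t * x)) (move q (q + 1) (residue t Z r)) -
    inv_sum (\<lambda>x. f (int t * x)) (residue t Z r)"
proof -
  let ?g = "\<lambda>x. f (int t * x)"
  have "(\<Sum>s\<in>{0..<int t}. inv_sum ?g (residue t (move (int t * q + r) (int t * q + r + int t) Z) s)) =
      inv_sum ?g (move q (q + 1) (residue t Z r)) + (\<Sum>s\<in>{0..<int t} - {r}. inv_sum ?g (residue t Z s))"
    using assms(3) by (simp add: sum.remove[of _ r] residue_move del: atLeastLessThan_iff)
  moreover have "(\<Sum>s\<in>{0..<int t}. inv_sum ?g (residue t Z s)) =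
      inv_sum ?g (residue t Z r) + (\<Sum>s\<in>{0..<int t} - {r}. inv_sum ?g (residue t Z s))"
    using assms(3) by (simp add: sum.remove[of _ r] del: atLeastLessThan_iff)
  ultimately show ?thesis
    using assms by (simp add: inv_sum_mod_residue bounded_maya_move)
qed

lemma sum_addable:
  assumes "t > 0" "\<And>r. finite (addable 1 (residue t Z r))"
  shows "finite (addable (int t) Z)"
    "(\<Sum>k\<in>addable (int t) Z. g k) =
      (\<Sum>r\<in>{0..<int t}. \<Sum>q\<in>addable 1 (residue t Z r). g (int t * q + r))"
proof -
  let ?S = "SIGMA r:{0..<int t}. addable 1 (residue t Z r)"
  have "bij_betw (\<lambda>(r, q). int t * q + r) ?S (addable (int t) Z)"
    by (rule bij_betw_byWitness[where f' = "\<lambda>k. (k mod int t, k div int t)"])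
      (use assms(1) in \<open>auto simp: addable_def residue_def algebra_simps\<close>)
  then show "finite (addable (int t) Z)" "(\<Sum>k\<in>addable (int t) Z. g k) =
      (\<Sum>r\<in>{0..<int t}. \<Sum>q\<in>addable 1 (residue t Z r). g (int t * q + r))"
    using assms(2) bij_betw_finite[of _ ?S "addable (int t) Z"]
    by (auto simp: sum.Sigma split_beta sum.reindex_bij_betw[symmetric])
qed

text \<open>A move changes only one runner, so its weight and increment are those of that runner.
  Each of the \<open>t\<close> runners contributes mass \<open>1 / t\<close>, which makes the total
  1; the contributions \<open>t * (3 * w + 1)\<close>, with \<open>w\<close> the number of
  inversions on the runner, add up to the second moment formula.\<close>

lemma inv_sum_mod_moments:
  fixes Z :: "int set"
  assumes "bounded_maya Z" "t > 0"
  defines "p \<equiv> \<lambda>k. exp (inv_sum_mod t (\<lambda>x. ln (of_int x)) Z -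
      inv_sum_mod t (\<lambda>x. ln (of_int x)) (move k (k + int t) Z))"
    and "d \<equiv> \<lambda>k. inv_sum_mod t (\<lambda>x. (of_int x)\<^sup>2) (move k (k + int t) Z) -
      inv_sum_mod t (\<lambda>x. (of_int x)\<^sup>2) Z"
  shows "finite (addable (int t) Z)" "(\<Sum>k\<in>addable (int t) Z. p k) = 1"
    "(\<Sum>k\<in>addable (int t) Z. p k * d k) = (real t)\<^sup>2 + 3 * real t * inv_sum_mod t (\<lambda>_. 1) Z"
proof -
  define M where "M = residue t Z"
  have M: "bounded_maya (M r)" for r using assms bounded_maya_residue by (simp add: M_def)
  have t: "real t > 0" using assms by simp
  note mom = plancherel_moments[OF M t]
  define p' where "p' r q = exp (inv_sum (\<lambda>x. ln (t * of_int x)) (M r) -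
      inv_sum (\<lambda>x. ln (t * of_int x)) (move q (q + 1) (M r)))" for r q
  define d' where "d' r q = inv_sum (\<lambda>x. (t * of_int x)\<^sup>2) (move q (q + 1) (M r)) -
      inv_sum (\<lambda>x. (t * of_int x)\<^sup>2) (M r)" for r q
  have p: "p (int t * q + r) = p' r q" if "r \<in> {0..<int t}" for r q
    using inv_sum_mod_move[OF assms(1,2) that, of "\<lambda>x. ln (of_int x)" q]
    by (simp add: p_def p'_def M_def[symmetric])
  have d: "d (int t * q + r) = d' r q" if "r \<in> {0..<int t}" for r q
    using inv_sum_mod_move[OF assms(1,2) that, of "\<lambda>x. (of_int x)\<^sup>2" q]
    by (simp add: d_def d'_def M_def[symmetric])
  have fin: "\<And>r. finite (addable 1 (residue t Z r))" using mom(1) by (simp add: M_def)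
  then show "finite (addable (int t) Z)" using sum_addable assms(2) by blast
  have "(\<Sum>k\<in>addable (int t) Z. p k) = (\<Sum>r\<in>{0..<int t}. \<Sum>q\<in>addable 1 (M r). p' r q)"
    unfolding sum_addable(2)[OF assms(2) fin] M_def by (intro sum.cong refl p)
  also have "\<dots> = 1" using mom(2) t by (simp add: p'_def)
  finally show "(\<Sum>k\<in>addable (int t) Z. p k) = 1" .
  have "(\<Sum>k\<in>addable (int t) Z. p k * d k) =
      (\<Sum>r\<in>{0..<int t}. \<Sum>q\<in>addable 1 (M r). p' r q * d' r q)"
    unfolding sum_addable(2)[OF assms(2) fin] M_def by (intro sum.cong refl) (simp only: p d)
  also have "\<dots> = (\<Sum>r\<in>{0..<int t}. t * (3 * inv_sum (\<lambda>_. 1) (M r) + 1))"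
    using mom(3) by (simp add: p'_def d'_def)
  also have "\<dots> = (real t)\<^sup>2 + 3 * real t * inv_sum_mod t (\<lambda>_. 1) Z"
    using assms by (simp add: inv_sum_mod_residue M_def sum_distrib_left[symmetric] sum.distrib
        power2_eq_square algebra_simps)
  finally show "(\<Sum>k\<in>addable (int t) Z. p k * d k) = (real t)\<^sup>2 + 3 * real t * inv_sum_mod t (\<lambda>_. 1) Z" .
qed

lemma inv_sum_mod_1_move:
  assumes "bounded_maya Z" "t > 0" "k \<in> addable (int t) Z"
  shows "inv_sum_mod t (\<lambda>_. 1) (move k (k + int t) Z) = inv_sum_mod t (\<lambda>_. 1) Z + 1"
proof -
  define q r where "q = k div int t" and "r = k mod int t"
  have k: "k = int t * q + r" by (simp add: q_def r_def)
  have r: "r \<in> {0..<int t}" using assms by (simp add: r_def)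
  have "q \<in> addable 1 (residue t Z r)"
    using assms(3) unfolding k by (auto simp: addable_def residue_def algebra_simps)
  then show ?thesis
    using inv_sum_mod_move[OF assms(1,2) r, of "\<lambda>_. 1" q]
      inv_sum_1_move[OF bounded_maya_residue[OF assms(1,2)]] by (simp add: k)
qed

section \<open>Bead sets of partitions\<close>

text \<open>The beta-numbers of the partition, shifted to agree with the indices of the
  01-sequence.\<close>

definition edge :: "nat list \<Rightarrow> nat \<Rightarrow> int" where
  "edge \<rho> i = int (row \<rho> i) - int (i + 1)"

definition beads :: "nat list \<Rightarrow> int set" where
  "beads \<rho> = {k. seq01 \<rho> k = 0}"

lemma beads_eq_range: "beads \<rho> = range (edge \<rho>)"
  by (auto simp: beads_def seq01_def edge_def)

lemma edge_strict_antimono: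
  assumes "is_partition \<rho>" "i < i'"
  shows "edge \<rho> i' < edge \<rho> i"
  using row_antimono[OF assms(1), of i i'] assms(2) by (simp add: edge_def)

lemma inj_edge: "is_partition \<rho> \<Longrightarrow> inj (edge \<rho>)"
  by (rule injI) (metis edge_strict_antimono linorder_neqE_nat order_less_irrefl)

lemma row_inject:
  assumes "is_partition \<rho>" "is_partition \<rho>'" "row \<rho> = row \<rho>'"
  shows "\<rho> = \<rho>'"
proof -
  have "no_trailing ((=) 0) \<rho>" "no_trailing ((=) 0) \<rho>'"
    using assms(1,2) unfolding is_partition_def no_trailing_unfold by (metis last_in_set)+
  then show ?thesis using assms(3) by (simp add: nth_default_eq_iff)
qed

text \<open>The \<open>n\<close>-th term must be the \<open>n\<close>-th largest element of the
  range. If \<open>b n = c m\<close> with \<open>m < n\<close>, the induction hypothesis would give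
  \<open>b n = b m\<close>; hence \<open>n \<le> m\<close> and \<open>b n \<le> c n\<close>, and the
  converse is symmetric.\<close>

lemma strict_antimono_range_unique:
  fixes b c :: "nat \<Rightarrow> int"
  assumes b: "\<And>i j. i < j \<Longrightarrow> b j < b i" and c: "\<And>i j. i < j \<Longrightarrow> c j < c i"
    and eq: "range b = range c"
  shows "b = c"
proof
  fix n show "b n = c n"
  proof (induction n rule: less_induct)
    case (less n)
    obtain m where m: "b n = c m" using eq by (metis rangeE rangeI)
    obtain m' where m': "c n = b m'" using eq by (metis rangeE rangeI)
    have "n \<le> m" using less[of m] b[of m n] m by (metis less_irrefl not_le)
    then have "b n \<le> c n" using c[of n m] m by (metis less_le order_refl)
    have "n \<le> m'" using less[of m'] c[of m' n] m' by (metis less_irrefl not_le)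
    then have "c n \<le> b n" using b[of n m'] m' by (metis less_le order_refl)
    then show ?case using \<open>b n \<le> c n\<close> by simp
  qed
qed

lemma beads_inject:
  assumes "is_partition \<rho>" "is_partition \<rho>'" "beads \<rho> = beads \<rho>'"
  shows "\<rho> = \<rho>'"
proof -
  have "edge \<rho> = edge \<rho>'"
    by (rule strict_antimono_range_unique)
      (use assms edge_strict_antimono in \<open>auto simp: beads_eq_range\<close>)
  then have "row \<rho> i = row \<rho>' i" for i by (auto simp: edge_def dest!: fun_cong[of _ _ i])
  then show ?thesis using row_inject[OF assms(1,2)] by blast
qed

lemma edge_tail: "length \<rho> \<le> i \<Longrightarrow> edge \<rho> i = - int i - 1"
  by (simp add: edge_def row_eq_0)

lemma beads_below:
  assumes "length \<rho> \<le> L"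
  shows "{..<- int L} \<subseteq> beads \<rho>"
proof
  fix k assume "k \<in> {..<- int L}"
  then have "edge \<rho> (nat (- k - 1)) = k" using assms by (subst edge_tail) auto
  then show "k \<in> beads \<rho>" unfolding beads_eq_range by (metis rangeI)
qed

lemma beads_window:
  assumes "length \<rho> \<le> L"
  shows "beads \<rho> \<inter> {- int L..} = edge \<rho> ` {..<L}"
proof (intro set_eqI iffI)
  fix k assume "k \<in> beads \<rho> \<inter> {- int L..}"
  then obtain i where i: "k = edge \<rho> i" "- int L \<le> k" by (auto simp: beads_eq_range)
  then have "i < L" using edge_tail[of \<rho> i] assms by (cases "i < L") auto
  then show "k \<in> edge \<rho> ` {..<L}" using i by auto
next
  fix k assume "k \<in> edge \<rho> ` {..<L}"
  then show "k \<in> beads \<rho> \<inter> {- int L..}" by (auto simp: beads_eq_range edge_def)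
qed

lemma bounded_maya_beads:
  assumes "is_partition \<rho>"
  shows "bounded_maya (beads \<rho>)"
proof -
  have "{..- int (length \<rho>) - 1} \<subseteq> beads \<rho>" using beads_below[of \<rho> "length \<rho>"] by auto
  moreover have "edge \<rho> i \<le> edge \<rho> 0" for i
    using edge_strict_antimono[OF assms, of 0 i] by (cases "i = 0") auto
  then have "beads \<rho> \<subseteq> {..edge \<rho> 0}" by (auto simp: beads_eq_range)
  ultimately show ?thesis unfolding bounded_maya_def by blast
qed

text \<open>The correction term depends only on \<open>L\<close>, so sizes of partitions can be
  compared through the bead positions in a common window.\<close>

lemma sum_list_beads:
  assumes "is_partition \<rho>" "length \<rho> \<le> L"
  shows "int (sum_list \<rho>) = \<Sum>(beads \<rho> \<inter> {- int L..}) + (\<Sum>i<L. int (i + 1))"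
proof -
  have "sum_list \<rho> = (\<Sum>i<length \<rho>. row \<rho> i)"
    by (simp add: sum_list_sum_nth atLeast0LessThan nth_default_nth)
  also have "\<dots> = (\<Sum>i<L. row \<rho> i)"
    by (rule sum.mono_neutral_left) (use assms(2) in \<open>auto simp: row_eq_0\<close>)
  also have "int \<dots> = (\<Sum>i<L. edge \<rho> i) + (\<Sum>i<L. int (i + 1))"
    by (simp add: edge_def sum.distrib[symmetric] algebra_simps)
  also have "(\<Sum>i<L. edge \<rho> i) = \<Sum>(beads \<rho> \<inter> {- int L..})"
    unfolding beads_window[OF assms(2)]
    by (subst sum.reindex) (auto intro: inj_on_subset[OF inj_edge[OF assms(1)]])
  finally show ?thesis .
qed

section \<open>Partitions with a prescribed bead set\<close>

lemma partition_of_rows: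
  fixes g :: "nat \<Rightarrow> nat"
  assumes "antimono g" "g N = 0"
  obtains \<rho> where "is_partition \<rho>" "row \<rho> = g"
proof
  \<comment> \<open>Cutting at the first zero leaves only positive parts.\<close>
  define n where "n = (LEAST i. g i = 0)"
  have n: "g n = 0" unfolding n_def using assms(2) by (rule LeastI)
  have less: "g i \<noteq> 0" if "i < n" for i using that not_less_Least unfolding n_def by blast
  have ge: "g i = 0" if "n \<le> i" for i using antimonoD[OF assms(1) that] n by simp
  let ?\<rho> = "map g [0..<n]"
  show "row ?\<rho> = g" by (rule ext) (simp add: nth_default_def ge)
  show "is_partition ?\<rho>"
    unfolding is_partition_def using less antimonoD[OF assms(1)]
    by (force simp: sorted_wrt_iff_nth_less)
qed

text \<open>Having exactly \<open>L\<close> elements from \<open>-L\<close> on is the balance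
  condition, seen in a window. Listing the beads downwards and undoing the shift of
  \<open>edge\<close> gives the rows.\<close>

lemma beads_exists:
  assumes below: "{..<- int L} \<subseteq> Z" and fin: "finite (Z \<inter> {- int L..})" and card: "card (Z \<inter> {- int L..}) = L"
  shows "\<exists>\<rho>. is_partition \<rho> \<and> beads \<rho> = Z"
proof -
  define xs where "xs = rev (sorted_list_of_set (Z \<inter> {- int L..}))"
  have len: "length xs = L" by (simp add: xs_def card)
  have set: "set xs = Z \<inter> {- int L..}" using fin by (simp add: xs_def)
  have "sorted_wrt (>) xs" unfolding xs_def sorted_wrt_rev by simp
  then have dec: "xs ! j < xs ! i" if "i < j" "j < L" for i j
    using that by (simp add: sorted_wrt_iff_nth_less len)
  \<comment> \<open>From index \<open>L\<close> on, the values continue with \<open>-L - 1\<close>,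
    \<open>-L - 2\<close> and so on, which are exactly the positions below the window.\<close>
  define b where "b i = (if i < L then xs ! i else - int i - 1)" for i
  have lo: "- int L \<le> xs ! i" if "i < L" for i
    using nth_mem[of i xs] that by (auto simp: set len)
  have b_dec: "b (Suc i) < b i" for i
    using dec[of i "Suc i"] lo[of i] by (auto simp: b_def)
  define g where "g i = b i + int i + 1" for i
  have "decseq g" unfolding decseq_Suc_iff using b_dec by (simp add: g_def) (metis add1_zle_eq add.commute)
  then have dec_g: "g j \<le> g i" if "i \<le> j" for i j using that by (simp add: decseq_def)
  \<comment> \<open>\<open>g\<close> decreases and vanishes at \<open>L\<close>, so the earlier
    values cannot be negative.\<close>
  have "g i \<ge> 0" for i
  proof (cases "i < L")
    case True
    then show ?thesis using dec_g[of i L] by (simp add: g_def b_def)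
  qed (simp add: g_def b_def)
  moreover have "antimono (\<lambda>i. nat (g i))" by (rule antimonoI) (simp add: dec_g nat_mono)
  moreover have "nat (g L) = 0" by (simp add: g_def b_def)
  ultimately obtain \<rho> where \<rho>: "is_partition \<rho>" "row \<rho> = (\<lambda>i. nat (g i))" and g0: "\<And>i. g i \<ge> 0"
    using partition_of_rows by metis
  have "edge \<rho> = b" unfolding edge_def \<rho>(2) using g0 by (auto simp: g_def)
  then have "beads \<rho> = range b" by (simp add: beads_eq_range)
  also have "range b = Z"
  proof (intro set_eqI iffI)
    fix k assume "k \<in> range b"
    then obtain i where "k = b i" by auto
    then show "k \<in> Z" using nth_mem[of i xs] below by (cases "i < L") (auto simp: b_def set len)
  next
    fix k assume k: "k \<in> Z"
    show "k \<in> range b"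
    proof (cases "- int L \<le> k")
      case True
      then have "k \<in> set xs" using k set by auto
      then obtain i where "i < L" "xs ! i = k" by (auto simp: in_set_conv_nth len)
      then show ?thesis by (auto simp: b_def intro!: image_eqI[of _ _ i])
    next
      case False
      then show ?thesis by (intro image_eqI[of _ _ "nat (- k - 1)"]) (auto simp: b_def)
    qed
  qed
  finally show ?thesis using \<rho>(1) by blast
qed

lemma move_window:
  assumes "is_partition \<nu>" "length \<nu> \<le> L" "- int L \<le> k" "- int L \<le> l" "k \<in> beads \<nu>" "l \<notin> beads \<nu>"
  shows "finite (move k l (beads \<nu>) \<inter> {- int L..})" "card (move k l (beads \<nu>) \<inter> {- int L..}) = L"
    "\<Sum>(move k l (beads \<nu>) \<inter> {- int L..}) = \<Sum>(beads \<nu> \<inter> {- int L..}) + l - k"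
proof -
  define W where "W = beads \<nu> \<inter> {- int L..}"
  have W: "finite W" "card W = L"
    unfolding W_def beads_window[OF assms(2)]
    by (auto simp: card_image inj_on_subset[OF inj_edge[OF assms(1)]])
  have kl: "k \<in> W" "l \<notin> W" using assms by (auto simp: W_def)
  have eq: "move k l (beads \<nu>) \<inter> {- int L..} = insert l (W - {k})" using assms by (auto simp: W_def)
  show "finite (move k l (beads \<nu>) \<inter> {- int L..})" "card (move k l (beads \<nu>) \<inter> {- int L..}) = L"
    unfolding eq using W kl card_gt_0_iff[of W] by auto
  show "\<Sum>(move k l (beads \<nu>) \<inter> {- int L..}) = \<Sum>(beads \<nu> \<inter> {- int L..}) + l - k"
    unfolding eq W_def[symmetric] using W kl by (simp add: sum.remove[of W k])
qed

lemma beads_move_exists: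
  assumes "is_partition \<nu>" "k \<in> beads \<nu>" "l \<notin> beads \<nu>"
  shows "\<exists>\<rho>. is_partition \<rho> \<and> beads \<rho> = move k l (beads \<nu>)"
proof -
  \<comment> \<open>The window reaches below both ends of the move and below all rows of
    \<open>\<nu>\<close>.\<close>
  define L where "L = length \<nu> + nat \<bar>k\<bar> + nat \<bar>l\<bar>"
  have L: "length \<nu> \<le> L" "- int L \<le> k" "- int L \<le> l" by (auto simp: L_def)
  have "{..<- int L} \<subseteq> move k l (beads \<nu>)" using beads_below[OF L(1)] L(2) by auto
  then show ?thesis using beads_exists move_window(1,2)[OF assms(1) L assms(2,3)] by blast
qed

lemma sum_list_move:
  assumes "is_partition \<nu>" "is_partition \<rho>" "k \<in> beads \<nu>" "l \<notin> beads \<nu>"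
    "beads \<rho> = move k l (beads \<nu>)"
  shows "int (sum_list \<rho>) = int (sum_list \<nu>) + l - k"
proof -
  define L where "L = length \<rho> + length \<nu> + nat \<bar>k\<bar> + nat \<bar>l\<bar>"
  have L: "length \<nu> \<le> L" "- int L \<le> k" "- int L \<le> l" "length \<rho> \<le> L" by (auto simp: L_def)
  show ?thesis
    using sum_list_beads[OF assms(1) L(1)] sum_list_beads[OF assms(2) L(4)]
      move_window(3)[OF assms(1) L(1-3) assms(3,4)] assms(5) by simp
qed

section \<open>Hook additions as bead moves\<close>

lemma adds_hook_iff:
  assumes "t > 0"
  shows "adds_hook t \<nu> \<rho> \<longleftrightarrow> is_partition \<nu> \<and> is_partition \<rho> \<and>
    (\<exists>k\<in>addable (int t) (beads \<nu>). beads \<rho> = move k (k + int t) (beads \<nu>))"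
proof -
  have 01: "seq01 \<sigma> k = (if k \<in> beads \<sigma> then 0 else 1)" for \<sigma> k by (auto simp: beads_def seq01_def)
  have "seq01 \<rho> = (seq01 \<nu>)(k := 1, k + int t := 0) \<longleftrightarrow> beads \<rho> = move k (k + int t) (beads \<nu>)" for k
  proof
    assume "seq01 \<rho> = (seq01 \<nu>)(k := 1, k + int t := 0)"
    then show "beads \<rho> = move k (k + int t) (beads \<nu>)" unfolding beads_def by auto
  next
    assume "beads \<rho> = move k (k + int t) (beads \<nu>)"
    then show "seq01 \<rho> = (seq01 \<nu>)(k := 1, k + int t := 0)"
      using assms by (intro ext) (simp add: 01)
  qed
  moreover have "seq01 \<nu> k = 0 \<and> seq01 \<nu> (k + int t) = 1 \<longleftrightarrow> k \<in> addable (int t) (beads \<nu>)" for k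
    by (simp add: addable_def 01)
  ultimately show ?thesis unfolding adds_hook_def by blast
qed

lemma adds_hook_sum_list:
  assumes "t > 0" "adds_hook t \<nu> \<rho>"
  shows "sum_list \<rho> = sum_list \<nu> + t"
  using assms sum_list_move[of \<nu> \<rho>] by (fastforce simp: adds_hook_iff addable_def)

lemma sum_adds_hook:
  fixes g :: "int set \<Rightarrow> real"
  assumes "t > 0" "is_partition \<nu>"
  shows "(\<Sum>\<rho> | adds_hook t \<nu> \<rho>. g (beads \<rho>)) =
    (\<Sum>k\<in>addable (int t) (beads \<nu>). g (move k (k + int t) (beads \<nu>)))"
proof -
  let ?m = "\<lambda>k. move k (k + int t) (beads \<nu>)"
  have "beads ` {\<rho>. adds_hook t \<nu> \<rho>} = ?m ` addable (int t) (beads \<nu>)"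
  proof (intro set_eqI iffI)
    fix Z assume "Z \<in> ?m ` addable (int t) (beads \<nu>)"
    then obtain k where k: "k \<in> addable (int t) (beads \<nu>)" "Z = ?m k" by auto
    then obtain \<rho> where "is_partition \<rho>" "beads \<rho> = ?m k"
      using beads_move_exists[OF assms(2), of k "k + int t"] by (auto simp: addable_def)
    then show "Z \<in> beads ` {\<rho>. adds_hook t \<nu> \<rho>}" using k assms by (auto simp: adds_hook_iff)
  qed (use assms in \<open>auto simp: adds_hook_iff\<close>)
  moreover have "inj_on beads {\<rho>. adds_hook t \<nu> \<rho>}"
    using assms by (intro inj_onI beads_inject) (auto simp: adds_hook_iff)
  moreover have "inj_on ?m (addable (int t) (beads \<nu>))"
  proof (rule inj_onI)
    fix k l assume k: "k \<in> addable (int t) (beads \<nu>)" and eq: "?m k = ?m l"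
    \<comment> \<open>A move is recovered from its result: the only original bead missing afterwards
      is the moved one.\<close>
    have "k \<notin> ?m k" using assms(1) by simp
    then show "k = l" using k eq by (auto simp: addable_def)
  qed
  ultimately show ?thesis by (metis (no_types, lifting) sum.reindex_cong)
qed

section \<open>Hooks\<close>

definition column :: "nat list \<Rightarrow> nat \<Rightarrow> nat" where
  "column \<rho> j = card {i. (i, j) \<in> young_diagram \<rho>}"

lemma less_column_iff:
  assumes "is_partition \<rho>"
  shows "i < column \<rho> j \<longleftrightarrow> j < row \<rho> i"
proof -
  obtain m where m: "row \<rho> m \<le> j" "\<And>i. i < m \<Longrightarrow> j < row \<rho> i"
    using exists_least_iff[of "\<lambda>m. row \<rho> m \<le> j"] row_eq_0[of \<rho> "length \<rho>"]
    by (metis le0 le_refl not_le)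
  have iff: "j < row \<rho> i \<longleftrightarrow> i < m" for i
    using m row_antimono[OF assms, of m i] by (metis le_less_trans not_le)
  then have "{i. (i, j) \<in> young_diagram \<rho>} = {..<m}" by (auto simp: young_diagram_def)
  then show ?thesis using iff by (simp add: column_def)
qed

lemma column_antimono:
  assumes "is_partition \<rho>" "j \<le> j'"
  shows "column \<rho> j' \<le> column \<rho> j"
  using less_column_iff[OF assms(1)] assms(2) by (metis le_less_trans nat_less_le not_le_imp_less)

text \<open>Arm and leg together measure the distance along the boundary from the horizontal edge
  below the column to the vertical edge at the end of the row.\<close>

lemma hook_length_eq:
  assumes "is_partition \<rho>" "j < row \<rho> i"
  shows "int (hook_length \<rho> (i, j)) = edge \<rho> i - (int j - int (column \<rho> j))"
proof -
  have "{j'. j' > j \<and> (i, j') \<in> young_diagram \<rho>} = {j<..<row \<rho> i}" by (auto simp: young_diagram_def)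
  moreover have "{i'. i' > i \<and> (i', j) \<in> young_diagram \<rho>} = {i<..<column \<rho> j}"
    using less_column_iff[OF assms(1)] by (auto simp: young_diagram_def)
  moreover have "i < column \<rho> j" using less_column_iff[OF assms(1)] assms(2) by simp
  ultimately show ?thesis using assms(2) by (simp add: hook_length_def edge_def)
qed

text \<open>A horizontal edge precedes a vertical edge on the boundary exactly when their column and
  row meet in a box of the diagram. Both edge indexings are injective.\<close>

lemma bij_betw_young_diagram_inversions:
  assumes "is_partition \<rho>"
  shows "bij_betw (\<lambda>(i, j). (int j - int (column \<rho> j), edge \<rho> i)) (young_diagram \<rho>) (inversions (beads \<rho>))"
  unfolding bij_betw_def
proof
  define col where "col j = int j - int (column \<rho> j)" for j
  have col_less: "col j < col j'" if "j < j'" for j j'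
    using column_antimono[OF assms, of j j'] that by (simp add: col_def)
  have less_iff: "col j < edge \<rho> i \<longleftrightarrow> j < row \<rho> i" for i j
    using less_column_iff[OF assms, of i j] by (cases "j < row \<rho> i") (auto simp: col_def edge_def)
  have col: "k \<notin> beads \<rho> \<longleftrightarrow> (\<exists>j. k = col j)" for k
  proof -
    have "k \<notin> beads \<rho> \<longleftrightarrow> seq01 \<rho> k = 1" by (simp add: beads_def seq01_def)
    then show ?thesis using seq01_horizontal[OF assms, of k] by (simp add: col_def column_def)
  qed
  show "inj_on (\<lambda>(i, j). (int j - int (column \<rho> j), edge \<rho> i)) (young_diagram \<rho>)"
  proof (rule inj_onI, clarify)
    fix i j i' j'
    assume "int j - int (column \<rho> j) = int j' - int (column \<rho> j')" "edge \<rho> i = edge \<rho> i'"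
    then show "i = i' \<and> j = j'"
      using col_less[of j j'] col_less[of j' j] injD[OF inj_edge[OF assms]]
      by (cases j j' rule: linorder_cases) (auto simp: col_def)
  qed
  show "(\<lambda>(i, j). (int j - int (column \<rho> j), edge \<rho> i)) ` young_diagram \<rho> = inversions (beads \<rho>)"
    unfolding col_def[symmetric]
  proof (intro set_eqI iffI)
    fix x assume "x \<in> (\<lambda>(i, j). (col j, edge \<rho> i)) ` young_diagram \<rho>"
    then show "x \<in> inversions (beads \<rho>)"
      using less_iff col by (auto simp: young_diagram_def inversions_def beads_eq_range)
  next
    fix x assume "x \<in> inversions (beads \<rho>)"
    then obtain a b where x: "x = (a, b)" "a \<notin> beads \<rho>" "b \<in> beads \<rho>" "a < b" by (auto simp: inversions_def)
    then obtain i j where "a = col j" "b = edge \<rho> i" using col by (auto simp: beads_eq_range)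
    then show "x \<in> (\<lambda>(i, j). (col j, edge \<rho> i)) ` young_diagram \<rho>"
      using x less_iff by (auto simp: young_diagram_def intro!: image_eqI[of _ _ "(i, j)"])
  qed
qed

lemma sum_hooks_mod:
  assumes "is_partition \<rho>"
  shows "(\<Sum>b | b \<in> young_diagram \<rho> \<and> t dvd hook_length \<rho> b. f (real (hook_length \<rho> b))) =
    inv_sum_mod t (\<lambda>x. f (of_int x)) (beads \<rho>)"
proof -
  let ?F = "\<lambda>x. if int t dvd x then f (real_of_int x) else 0"
  have "(\<Sum>b | b \<in> young_diagram \<rho> \<and> t dvd hook_length \<rho> b. f (real (hook_length \<rho> b))) =
      (\<Sum>b\<in>young_diagram \<rho>. ?F (int (hook_length \<rho> b)))"
    using finite_young_diagram[of \<rho>] by (simp add: sum.inter_filter cong: if_cong)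
  also have "\<dots> = (\<Sum>b\<in>young_diagram \<rho>. (\<lambda>(i, j). ?F (j - i))
      ((\<lambda>(i, j). (int j - int (column \<rho> j), edge \<rho> i)) b))"
  proof (rule sum.cong)
    fix b assume b: "b \<in> young_diagram \<rho>"
    obtain i j where ij: "b = (i, j)" by (cases b)
    then have "j < row \<rho> i" using b by (simp add: young_diagram_def)
    from hook_length_eq[OF assms this]
    show "?F (int (hook_length \<rho> b)) = (\<lambda>(i, j). ?F (j - i))
        ((\<lambda>(i, j). (int j - int (column \<rho> j), edge \<rho> i)) b)" by (simp only: ij prod.case)
  qed simp
  also have "\<dots> = (\<Sum>x\<in>inversions (beads \<rho>). (\<lambda>(i, j). ?F (j - i)) x)"
    by (rule sum.reindex_bij_betw[OF bij_betw_young_diagram_inversions[OF assms]])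
  also have "\<dots> = inv_sum_mod t (\<lambda>x. f (of_int x)) (beads \<rho>)"
  proof -
    have "{(i, j). (i, j) \<in> inversions (beads \<rho>) \<and> int t dvd j - i} =
        {x \<in> inversions (beads \<rho>). int t dvd snd x - fst x}" by auto
    then show ?thesis
      unfolding inv_sum_mod_def
      using finite_inversions[OF bounded_maya_beads[OF assms]]
      by (simp add: sum.inter_filter split_beta cong: if_cong)
  qed
  finally show ?thesis .
qed

lemma hook_G_eq:
  assumes "is_partition \<rho>"
  shows "hook_G t \<rho> = exp (- inv_sum_mod t (\<lambda>x. ln (of_int x)) (beads \<rho>))"
proof -
  let ?H = "{b \<in> young_diagram \<rho>. t dvd hook_length \<rho> b}"
  have "real (\<Prod>\<^sub># {#h \<in># hook_lengths \<rho>. t dvd h#}) = (\<Prod>b\<in>?H. real (hook_length \<rho> b))"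
    using finite_young_diagram[of \<rho>]
    by (simp add: hook_lengths_def filter_mset_image_mset prod_unfold_prod_mset[symmetric])
  \<comment> \<open>Hook lengths are at least 1, so \<open>exp\<close> inverts \<open>ln\<close> on
    them.\<close>
  also have "\<dots> = (\<Prod>b\<in>?H. exp (ln (real (hook_length \<rho> b))))"
    by (intro prod.cong) (auto simp: hook_length_def)
  also have "\<dots> = exp (\<Sum>b\<in>?H. ln (real (hook_length \<rho> b)))"
    using finite_young_diagram[of \<rho>] by (simp add: exp_sum)
  also have "(\<Sum>b\<in>?H. ln (real (hook_length \<rho> b))) = inv_sum_mod t (\<lambda>x. ln (of_int x)) (beads \<rho>)"
    using sum_hooks_mod[OF assms, where t = t and f = ln] by simp
  finally show ?thesis by (simp add: hook_G_def exp_minus inverse_eq_divide)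
qed

lemma inv_sum_mod_core:
  fixes f :: "real \<Rightarrow> real"
  assumes "is_core t \<mu>"
  shows "inv_sum_mod t (\<lambda>x. f (of_int x)) (beads \<mu>) = 0"
proof -
  have empty: "{b. b \<in> young_diagram \<mu> \<and> t dvd hook_length \<mu> b} = {}"
    using assms finite_young_diagram[of \<mu>] by (auto simp: is_core_def hook_lengths_def)
  have "is_partition \<mu>" using assms by (simp add: is_core_def)
  from sum_hooks_mod[OF this, of f t] show ?thesis unfolding empty by simp
qed

section \<open>Weights and commuting hook removals\<close>

abbreviation mod_weight :: "nat \<Rightarrow> nat list \<Rightarrow> real" where
  "mod_weight t \<rho> \<equiv> inv_sum_mod t (\<lambda>_. 1) (beads \<rho>)"

lemma mod_weight_adds_hook:
  assumes "t > 0" "adds_hook t \<nu> \<rho>"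
  shows "mod_weight t \<rho> = mod_weight t \<nu> + 1"
  using assms inv_sum_mod_1_move[OF bounded_maya_beads] by (auto simp: adds_hook_iff)

text \<open>Adding a hook raises the nonnegative weight by 1, whereas a core has weight 0.\<close>

lemma core_not_adds_hook:
  assumes "t > 0" "is_core t \<mu>"
  shows "\<not> adds_hook t \<nu> \<mu>"
proof
  assume "adds_hook t \<nu> \<mu>"
  moreover have "mod_weight t \<nu> \<ge> 0" unfolding inv_sum_mod_def by (rule sum_nonneg) auto
  ultimately show False
    using mod_weight_adds_hook[OF assms(1)] inv_sum_mod_core[OF assms(2), of "\<lambda>_. 1"] by fastforce
qed

lemma move_inverse: "k \<in> M \<Longrightarrow> l \<notin> M \<Longrightarrow> move l k (move k l M) = M"
  by auto

lemma move_commute: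
  assumes "k \<in> M" "l \<in> M" "k' \<notin> M" "l' \<notin> M" "k \<noteq> l" "k' \<noteq> l'"
  shows "move k' k (move l l' (move k k' M)) = move l l' M"
  using assms by auto

text \<open>Two different removals move different beads to different places, so both can be carried
  out, in either order.\<close>

lemma adds_hook_diamond:
  assumes "t > 0" "adds_hook t \<nu>1 \<rho>" "adds_hook t \<nu>2 \<rho>" "\<nu>1 \<noteq> \<nu>2"
  obtains \<nu> where "adds_hook t \<nu> \<nu>1" "adds_hook t \<nu> \<nu>2"
proof -
  have part: "is_partition \<nu>1" "is_partition \<nu>2" using assms by (auto simp: adds_hook_def)
  obtain k k' where k: "k \<in> beads \<nu>1" "k' \<notin> beads \<nu>1" "beads \<rho> = move k k' (beads \<nu>1)" "k' = k + int t"
    using assms by (auto simp: adds_hook_iff addable_def)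
  obtain l l' where l: "l \<in> beads \<nu>2" "l' \<notin> beads \<nu>2" "beads \<rho> = move l l' (beads \<nu>2)" "l' = l + int t"
    using assms by (auto simp: adds_hook_iff addable_def)
  have ne: "k \<noteq> k'" "l \<noteq> l'" using k(4) l(4) assms(1) by auto
  have b: "beads \<nu>1 = move k' k (beads \<rho>)" "beads \<nu>2 = move l' l (beads \<rho>)"
    using move_inverse k(1-3) l(1-3) by auto
  have kl: "k \<notin> beads \<rho>" "k' \<in> beads \<rho>" "l \<notin> beads \<rho>" "l' \<in> beads \<rho>"
    using k(1-3) l(1-3) ne by auto
  \<comment> \<open>With equal vacated positions, the same bead of \<open>\<rho>\<close> would be
    moved back in both cases, and the two partitions would coincide.\<close>
  have "k \<noteq> l" using b beads_inject[OF part] assms(4) k(4) l(4) by metis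
  then have "k' \<noteq> l'" using k(4) l(4) by simp
  have l1: "l' \<in> beads \<nu>1" "l \<notin> beads \<nu>1" using kl \<open>k \<noteq> l\<close> \<open>k' \<noteq> l'\<close> unfolding b by auto
  then obtain \<nu> where \<nu>: "is_partition \<nu>" "beads \<nu> = move l' l (beads \<nu>1)"
    using beads_move_exists[OF part(1)] by blast
  have "beads \<nu>1 = move l l' (beads \<nu>)" unfolding \<nu>(2) using move_inverse[OF l1] by simp
  moreover have "beads \<nu>2 = move k k' (beads \<nu>)"
    unfolding \<nu>(2) b using move_commute[OF kl(2,4,1,3)] \<open>k \<noteq> l\<close> \<open>k' \<noteq> l'\<close> by simp
  moreover have "l \<in> beads \<nu>" "l' \<notin> beads \<nu>" "k \<in> beads \<nu>" "k' \<notin> beads \<nu>"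
    using kl ne \<open>k \<noteq> l\<close> \<open>k' \<noteq> l'\<close> unfolding \<nu>(2) b by auto
  ultimately have "adds_hook t \<nu> \<nu>1" "adds_hook t \<nu> \<nu>2"
    unfolding adds_hook_iff[OF assms(1)] addable_def using \<nu>(1) part k(4) l(4) by blast+
  then show ?thesis by (rule that)
qed

section \<open>Cores\<close>

lemma hook_ge_terminal_exists:
  assumes "t > 0"
  shows "\<exists>\<nu>. hook_ge t \<rho> \<nu> \<and> (\<nexists>\<nu>'. adds_hook t \<nu>' \<nu>)"
proof (induction "sum_list \<rho>" arbitrary: \<rho> rule: less_induct)
  case less
  show ?case
  proof (cases "\<exists>\<rho>'. adds_hook t \<rho>' \<rho>")
    case True
    then obtain \<rho>' where \<rho>': "adds_hook t \<rho>' \<rho>" by blast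
    then have "sum_list \<rho>' < sum_list \<rho>" using adds_hook_sum_list[OF assms] assms by simp
    then obtain \<nu> where "hook_ge t \<rho>' \<nu>" "\<nexists>\<nu>'. adds_hook t \<nu>' \<nu>" using less by blast
    then show ?thesis using \<rho>' unfolding hook_ge_def by (meson rtranclp.rtrancl_into_rtrancl)
  next
    case False
    then show ?thesis unfolding hook_ge_def by blast
  qed
qed

text \<open>The argument of Newman's lemma: removals terminate because the size drops, and the
  diamond property gives local confluence.\<close>

lemma hook_ge_terminal_unique:
  assumes "t > 0" "hook_ge t \<rho> \<nu>1" "\<nexists>\<nu>'. adds_hook t \<nu>' \<nu>1" "hook_ge t \<rho> \<nu>2" "\<nexists>\<nu>'. adds_hook t \<nu>' \<nu>2"
  shows "\<nu>1 = \<nu>2"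
  using assms(2-)
proof (induction "sum_list \<rho>" arbitrary: \<rho> \<nu>1 \<nu>2 rule: less_induct)
  case less
  have IH: "\<sigma>1 = \<sigma>2" if "adds_hook t \<rho>' \<rho>" "hook_ge t \<rho>' \<sigma>1" "\<nexists>\<nu>'. adds_hook t \<nu>' \<sigma>1"
    "hook_ge t \<rho>' \<sigma>2" "\<nexists>\<nu>'. adds_hook t \<nu>' \<sigma>2" for \<rho>' \<sigma>1 \<sigma>2
    using less.hyps[of \<rho>' \<sigma>1 \<sigma>2] adds_hook_sum_list[OF assms(1) that(1)] assms(1) that by simp
  have cases: "\<rho> = \<nu> \<or> (\<exists>\<rho>'. adds_hook t \<rho>' \<rho> \<and> hook_ge t \<rho>' \<nu>)" if "hook_ge t \<rho> \<nu>" for \<nu>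
    using that unfolding hook_ge_def by (auto elim: rtranclp.cases)
  show ?case
  proof (cases "\<exists>\<rho>'. adds_hook t \<rho>' \<rho>")
    case True
    then have "\<rho> \<noteq> \<nu>1" "\<rho> \<noteq> \<nu>2" using less.prems by auto
    then obtain \<rho>1 \<rho>2 where 1: "adds_hook t \<rho>1 \<rho>" "hook_ge t \<rho>1 \<nu>1" and 2: "adds_hook t \<rho>2 \<rho>" "hook_ge t \<rho>2 \<nu>2"
      using cases less.prems by blast
    show ?thesis
    proof (cases "\<rho>1 = \<rho>2")
      case True
      then show ?thesis using IH 1 2 less.prems by blast
    next
      case False
      then obtain \<sigma> where \<sigma>: "adds_hook t \<sigma> \<rho>1" "adds_hook t \<sigma> \<rho>2"
        using adds_hook_diamond[OF assms(1) 1(1) 2(1)] by blast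
      \<comment> \<open>A terminal partition below \<open>\<sigma>\<close> lies below both
        \<open>\<rho>1\<close> and \<open>\<rho>2\<close>; the induction hypothesis identifies it
        with \<open>\<nu>1\<close> and with \<open>\<nu>2\<close>.\<close>
      obtain \<nu> where \<nu>: "hook_ge t \<sigma> \<nu>" "\<nexists>\<nu>'. adds_hook t \<nu>' \<nu>"
        using hook_ge_terminal_exists[OF assms(1)] by blast
      then have "hook_ge t \<rho>1 \<nu>" "hook_ge t \<rho>2 \<nu>"
        using \<sigma> unfolding hook_ge_def by (meson rtranclp.rtrancl_into_rtrancl)+
      then have "\<nu>1 = \<nu>" "\<nu>2 = \<nu>" using IH 1 2 \<nu>(2) less.prems by blast+
      then show ?thesis by simp
    qed
  next
    case False
    then show ?thesis using cases[OF less.prems(1)] cases[OF less.prems(3)] by auto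
  qed
qed

lemma hook_ge_is_partition:
  assumes "hook_ge t \<rho> \<mu>" "is_partition \<mu>"
  shows "is_partition \<rho>"
  using assms unfolding hook_ge_def by (auto elim: rtranclp.cases simp: adds_hook_def)

text \<open>A core is terminal under hook removal, and each partition has exactly one terminal
  partition below it. The condition on the core thus becomes reachability from
  \<open>\<mu>\<close>.\<close>

lemma core_of_eq_iff:
  assumes "t > 0" "is_core t \<mu>"
  shows "core_of t \<rho> = \<mu> \<longleftrightarrow> hook_ge t \<rho> \<mu>"
proof
  have "\<exists>!\<nu>. hook_ge t \<rho> \<nu> \<and> (\<nexists>\<nu>'. adds_hook t \<nu>' \<nu>)"
    using hook_ge_terminal_exists[OF assms(1)] hook_ge_terminal_unique[OF assms(1)] by (metis (no_types))
  from theI'[OF this] show "hook_ge t \<rho> \<mu>" if "core_of t \<rho> = \<mu>" using that unfolding core_of_def by blast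
next
  assume "hook_ge t \<rho> \<mu>"
  then show "core_of t \<rho> = \<mu>"
    unfolding core_of_def
    using core_not_adds_hook[OF assms] hook_ge_terminal_unique[OF assms(1)]
    by (intro the_equality) blast+
qed

section \<open>The growth process\<close>

definition hook_level :: "nat \<Rightarrow> nat list \<Rightarrow> nat \<Rightarrow> nat list set" where
  "hook_level t \<mu> n = {\<rho>. hook_ge t \<rho> \<mu> \<and> sum_list \<rho> = sum_list \<mu> + n * t}"

lemma finite_hook_level:
  assumes "is_partition \<mu>"
  shows "finite (hook_level t \<mu> n)"
  by (rule finite_subset[OF _ finite_partitions[of "sum_list \<mu> + n * t"]])
    (use hook_ge_is_partition[OF _ assms] in \<open>auto simp: hook_level_def\<close>)

lemma hook_ge_sum_list:
  assumes "t > 0" "hook_ge t \<rho> \<nu>"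
  shows "\<rho> = \<nu> \<or> sum_list \<nu> < sum_list \<rho>"
  using assms(2) unfolding hook_ge_def
  by (induction rule: rtranclp_induct) (use adds_hook_sum_list[OF assms(1)] assms(1) in fastforce)+

lemma hook_level_0:
  assumes "t > 0"
  shows "hook_level t \<mu> 0 = {\<mu>}"
  using hook_ge_sum_list[OF assms] by (force simp: hook_level_def hook_ge_def)

text \<open>Along a chain from the core, each step adds \<open>t\<close> to the size and 1 to the
  weight, which starts at 0. Hence the size determines the weight.\<close>

lemma mod_weight_hook_level:
  assumes "t > 0" "is_core t \<mu>" "\<rho> \<in> hook_level t \<mu> n"
  shows "mod_weight t \<rho> = real n"
proof -
  have "hook_ge t \<rho> \<mu>" using assms by (simp add: hook_level_def)
  then have "real (sum_list \<rho>) = real (sum_list \<mu>) + mod_weight t \<rho> * real t"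
    unfolding hook_ge_def
  proof (induction rule: rtranclp_induct)
    case base
    then show ?case using inv_sum_mod_core[OF assms(2), of "\<lambda>_. 1"] by simp
  next
    case (step \<nu> \<rho>)
    then show ?case
      by (simp add: adds_hook_sum_list[OF assms(1) step(2)] mod_weight_adds_hook[OF assms(1) step(2)]
          algebra_simps)
  qed
  then show ?thesis using assms by (simp add: hook_level_def)
qed

text \<open>Each hook addition increases the size by \<open>t\<close>, so a chain with total
  increase \<open>t\<close> has exactly one step. The recursion therefore runs over the immediate
  predecessors.\<close>

lemma skew_F_Suc:
  assumes "t > 0" "\<rho> \<in> hook_level t \<mu> (Suc n)"
  shows "skew_F t \<rho> \<mu> = (\<Sum>\<nu> | \<nu> \<in> hook_level t \<mu> n \<and> adds_hook t \<nu> \<rho>. skew_F t \<nu> \<mu>)"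
proof -
  have "\<rho> \<noteq> \<mu>" using assms by (auto simp: hook_level_def)
  moreover have "{\<nu>. t > 0 \<and> hook_ge t \<rho> \<nu> \<and> hook_ge t \<nu> \<mu> \<and> sum_list \<rho> = sum_list \<nu> + t} =
      {\<nu>. \<nu> \<in> hook_level t \<mu> n \<and> adds_hook t \<nu> \<rho>}" (is "?A = ?B")
  proof (intro set_eqI iffI)
    fix \<nu> assume "\<nu> \<in> ?A"
    then have \<nu>: "hook_ge t \<rho> \<nu>" "hook_ge t \<nu> \<mu>" "sum_list \<rho> = sum_list \<nu> + t" by auto
    then have "\<rho> \<noteq> \<nu>" using assms(1) by auto
    then obtain \<nu>' where \<nu>': "adds_hook t \<nu>' \<rho>" "hook_ge t \<nu>' \<nu>"
      using \<nu>(1) unfolding hook_ge_def by (auto elim: rtranclp.cases)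
    then have "\<nu>' = \<nu>"
      using hook_ge_sum_list[OF assms(1) \<nu>'(2)] adds_hook_sum_list[OF assms(1) \<nu>'(1)] \<nu>(3) by auto
    then show "\<nu> \<in> ?B" using \<nu> \<nu>'(1) assms(2) by (auto simp: hook_level_def)
  next
    fix \<nu> assume "\<nu> \<in> ?B"
    then show "\<nu> \<in> ?A"
      using assms(1) adds_hook_sum_list[OF assms(1), of \<nu> \<rho>] by (auto simp: hook_level_def hook_ge_def)
  qed
  ultimately show ?thesis by (subst skew_F.simps) simp
qed

text \<open>Double counting of the steps between two consecutive levels, grouped by the upper or by
  the lower partition.\<close>

lemma sum_hook_level_Suc:
  fixes g :: "nat list \<Rightarrow> real"
  assumes "t > 0" "is_partition \<mu>"
  shows "(\<Sum>\<rho>\<in>hook_level t \<mu> (Suc n). real (skew_F t \<rho> \<mu>) * g \<rho>) =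
    (\<Sum>\<nu>\<in>hook_level t \<mu> n. real (skew_F t \<nu> \<mu>) * (\<Sum>\<rho> | adds_hook t \<nu> \<rho>. g \<rho>))"
proof -
  have "(\<Sum>\<rho>\<in>hook_level t \<mu> (Suc n). real (skew_F t \<rho> \<mu>) * g \<rho>) =
      (\<Sum>\<rho>\<in>hook_level t \<mu> (Suc n). \<Sum>\<nu> | \<nu> \<in> hook_level t \<mu> n \<and> adds_hook t \<nu> \<rho>. real (skew_F t \<nu> \<mu>) * g \<rho>)"
    by (intro sum.cong refl) (simp add: skew_F_Suc[OF assms(1)] sum_distrib_right)
  also have "\<dots> = (\<Sum>\<nu>\<in>hook_level t \<mu> n. \<Sum>\<rho> | \<rho> \<in> hook_level t \<mu> (Suc n) \<and> adds_hook t \<nu> \<rho>. real (skew_F t \<nu> \<mu>) * g \<rho>)"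
    by (rule sum.swap_restrict) (use finite_hook_level[OF assms(2)] in auto)
  also have "\<dots> = (\<Sum>\<nu>\<in>hook_level t \<mu> n. real (skew_F t \<nu> \<mu>) * (\<Sum>\<rho> | adds_hook t \<nu> \<rho>. g \<rho>))"
  proof (rule sum.cong)
    fix \<nu> assume \<nu>: "\<nu> \<in> hook_level t \<mu> n"
    have "\<rho> \<in> hook_level t \<mu> (Suc n)" if "adds_hook t \<nu> \<rho>" for \<rho>
      using \<nu> that adds_hook_sum_list[OF assms(1) that] unfolding hook_level_def hook_ge_def by auto
    then have "{\<rho>. \<rho> \<in> hook_level t \<mu> (Suc n) \<and> adds_hook t \<nu> \<rho>} = {\<rho>. adds_hook t \<nu> \<rho>}" by auto
    then show "(\<Sum>\<rho> | \<rho> \<in> hook_level t \<mu> (Suc n) \<and> adds_hook t \<nu> \<rho>. real (skew_F t \<nu> \<mu>) * g \<rho>) =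
        real (skew_F t \<nu> \<mu>) * (\<Sum>\<rho> | adds_hook t \<nu> \<rho>. g \<rho>)" by (simp add: sum_distrib_left)
  qed simp
  finally show ?thesis .
qed

section \<open>Mean growth of the squared hook lengths\<close>

abbreviation hook_square_sum :: "nat \<Rightarrow> nat list \<Rightarrow> real" where
  "hook_square_sum t \<rho> \<equiv> (\<Sum>b | b \<in> young_diagram \<rho> \<and> t dvd hook_length \<rho> b. (real (hook_length \<rho> b))\<^sup>2)"

text \<open>The quotient of \<open>hook_G\<close> after and before a move is the transition
  probability of that move, so the moments of the bead process carry over to partitions.\<close>

lemma hook_G_growth:
  assumes "t > 0" "is_partition \<nu>"
  shows "(\<Sum>\<rho> | adds_hook t \<nu> \<rho>. hook_G t \<rho>) = hook_G t \<nu>"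
    "(\<Sum>\<rho> | adds_hook t \<nu> \<rho>. hook_G t \<rho> * hook_square_sum t \<rho>) =
      hook_G t \<nu> * (hook_square_sum t \<nu> + (real t)\<^sup>2 + 3 * real t * mod_weight t \<nu>)"
proof -
  define Z where "Z = beads \<nu>"
  define l where "l = inv_sum_mod t (\<lambda>x. ln (real_of_int x))"
  define s where "s = inv_sum_mod t (\<lambda>x. (real_of_int x)\<^sup>2)"
  define m where "m k = move k (k + int t) Z" for k
  note mom = inv_sum_mod_moments[OF bounded_maya_beads[OF assms(2)] assms(1), folded Z_def, folded l_def s_def m_def]
  have part: "is_partition \<rho>" if "adds_hook t \<nu> \<rho>" for \<rho> using that by (simp add: adds_hook_def)
  have G: "hook_G t \<rho> = exp (- l (beads \<rho>))" and S: "hook_square_sum t \<rho> = s (beads \<rho>)" if "is_partition \<rho>" for \<rho>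
    using hook_G_eq[OF that] sum_hooks_mod[OF that, where f = "\<lambda>x. x\<^sup>2" and t = t] by (simp_all add: l_def s_def)
  have exp: "exp (- l (m k)) = exp (- l Z) * exp (l Z - l (m k))" for k by (simp add: exp_add[symmetric])
  have "(\<Sum>\<rho> | adds_hook t \<nu> \<rho>. hook_G t \<rho>) = (\<Sum>\<rho> | adds_hook t \<nu> \<rho>. exp (- l (beads \<rho>)))"
    by (intro sum.cong refl G part) simp
  also have "\<dots> = (\<Sum>k\<in>addable (int t) Z. exp (- l Z) * exp (l Z - l (m k)))"
    unfolding sum_adds_hook[OF assms, of "\<lambda>Z. exp (- l Z)"] exp[symmetric] by (simp add: m_def Z_def)
  also have "\<dots> = hook_G t \<nu>"
    unfolding sum_distrib_left[symmetric] mom(2) using G[OF assms(2)] by (simp add: Z_def)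
  finally show "(\<Sum>\<rho> | adds_hook t \<nu> \<rho>. hook_G t \<rho>) = hook_G t \<nu>" .
  have "(\<Sum>\<rho> | adds_hook t \<nu> \<rho>. hook_G t \<rho> * hook_square_sum t \<rho>) =
      (\<Sum>\<rho> | adds_hook t \<nu> \<rho>. exp (- l (beads \<rho>)) * s (beads \<rho>))"
    by (intro sum.cong refl) (simp add: G S part)
  also have "\<dots> = (\<Sum>k\<in>addable (int t) Z. exp (- l (m k)) * s (m k))"
    unfolding sum_adds_hook[OF assms, of "\<lambda>Z. exp (- l Z) * s Z"] by (simp add: m_def Z_def)
  \<comment> \<open>The new sum of squares is split into its increment and its old value, to apply
    the second moment to the former and the total mass to the latter.\<close>
  also have "\<dots> = (\<Sum>k\<in>addable (int t) Z. exp (- l Z) *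
      (exp (l Z - l (m k)) * (s (m k) - s Z) + s Z * exp (l Z - l (m k))))"
    by (intro sum.cong refl) (simp add: exp algebra_simps)
  also have "\<dots> = exp (- l Z) * ((real t)\<^sup>2 + 3 * real t * inv_sum_mod t (\<lambda>_. 1) Z + s Z)"
    unfolding sum_distrib_left[symmetric] sum.distrib mom(2,3) by simp
  finally show "(\<Sum>\<rho> | adds_hook t \<nu> \<rho>. hook_G t \<rho> * hook_square_sum t \<rho>) =
      hook_G t \<nu> * (hook_square_sum t \<nu> + (real t)\<^sup>2 + 3 * real t * mod_weight t \<nu>)"
    using G[OF assms(2)] S[OF assms(2)] by (simp add: Z_def algebra_simps)
qed

text \<open>The products of \<open>skew_F\<close> and \<open>hook_G\<close> form a probability
  distribution on each level: it starts as a point mass at the core, and every step preserves the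
  mass.\<close>

lemma sum_skew_F_hook_G:
  assumes "t > 0" "is_core t \<mu>"
  shows "(\<Sum>\<rho>\<in>hook_level t \<mu> n. real (skew_F t \<rho> \<mu>) * hook_G t \<rho>) = 1"
proof (induction n)
  case 0
  have "hook_G t \<mu> = 1"
    using hook_G_eq[of \<mu> t] inv_sum_mod_core[OF assms(2), of ln] assms(2) by (simp add: is_core_def)
  then show ?case using assms(1) by (simp add: hook_level_0 skew_F.simps)
next
  case (Suc n)
  have \<mu>: "is_partition \<mu>" using assms(2) by (simp add: is_core_def)
  have "is_partition \<nu>" if "\<nu> \<in> hook_level t \<mu> n" for \<nu>
    using that hook_ge_is_partition[OF _ \<mu>] by (auto simp: hook_level_def)
  then show ?case unfolding sum_hook_level_Suc[OF assms(1) \<mu>] using Suc hook_G_growth(1)[OF assms(1)] by simp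
qed

text \<open>The weight is constantly \<open>n\<close> on level \<open>n\<close>, so the mean
  increment is the same from every partition there. Its part linear in \<open>n\<close> accumulates
  to the binomial coefficient by Pascal's rule.\<close>

lemma sum_hook_level_square:
  assumes "t > 0" "is_core t \<mu>"
  shows "(\<Sum>\<rho>\<in>hook_level t \<mu> n. real (skew_F t \<rho> \<mu>) * (hook_G t \<rho> * hook_square_sum t \<rho>)) =
    real n * (real t)\<^sup>2 + 3 * real t * real (n choose 2)"
proof (induction n)
  case 0
  have "hook_square_sum t \<mu> = 0"
    using sum_hooks_mod[of \<mu> "\<lambda>x. x\<^sup>2" t] inv_sum_mod_core[OF assms(2), of "\<lambda>x. x\<^sup>2"] assms(2)
    by (simp add: is_core_def)
  then show ?case using assms(1) by (simp add: hook_level_0)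
next
  case (Suc n)
  have \<mu>: "is_partition \<mu>" using assms(2) by (simp add: is_core_def)
  have "(\<Sum>\<rho>\<in>hook_level t \<mu> (Suc n). real (skew_F t \<rho> \<mu>) * (hook_G t \<rho> * hook_square_sum t \<rho>)) =
      (\<Sum>\<nu>\<in>hook_level t \<mu> n. real (skew_F t \<nu> \<mu>) * (hook_G t \<nu> * hook_square_sum t \<nu>) +
        (real t ^ 2 + 3 * real t * real n) * (real (skew_F t \<nu> \<mu>) * hook_G t \<nu>))"
    unfolding sum_hook_level_Suc[OF assms(1) \<mu>]
  proof (intro sum.cong refl)
    fix \<nu> assume \<nu>: "\<nu> \<in> hook_level t \<mu> n"
    then have "is_partition \<nu>" using hook_ge_is_partition[OF _ \<mu>] by (auto simp: hook_level_def)
    then show "real (skew_F t \<nu> \<mu>) * (\<Sum>\<rho> | adds_hook t \<nu> \<rho>. hook_G t \<rho> * hook_square_sum t \<rho>) =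
        real (skew_F t \<nu> \<mu>) * (hook_G t \<nu> * hook_square_sum t \<nu>) +
        (real t ^ 2 + 3 * real t * real n) * (real (skew_F t \<nu> \<mu>) * hook_G t \<nu>)"
      unfolding hook_G_growth(2)[OF assms(1) \<open>is_partition \<nu>\<close>] mod_weight_hook_level[OF assms \<nu>]
      by (simp add: algebra_simps)
  qed
  also have "\<dots> = real n * (real t)\<^sup>2 + 3 * real t * real (n choose 2) + (real t ^ 2 + 3 * real t * real n)"
    unfolding sum.distrib sum_distrib_left[symmetric] Suc sum_skew_F_hook_G[OF assms] by simp
  also have "\<dots> = real (Suc n) * (real t)\<^sup>2 + 3 * real t * real (Suc n choose 2)"
    by (simp add: numeral_2_eq_2 algebra_simps)
  finally show ?case .
qed

theorem theorem1p7:
  fixes t n :: nat and \<mu> :: "nat list"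
  assumes "t > 0" and "is_core t \<mu>"
  shows "(\<Sum>\<rho> | is_partition \<rho> \<and> core_of t \<rho> = \<mu> \<and> sum_list \<rho> = sum_list \<mu> + n * t.
            real (skew_F t \<rho> \<mu>) * hook_G t \<rho> *
            (\<Sum>b | b \<in> young_diagram \<rho> \<and> t dvd hook_length \<rho> b. (real (hook_length \<rho> b))\<^sup>2))
         = real n * (real t)\<^sup>2 + 3 * real t * real (n choose 2)"
proof -
  have "is_partition \<mu>" using assms(2) by (simp add: is_core_def)
  then have "{\<rho>. is_partition \<rho> \<and> core_of t \<rho> = \<mu> \<and> sum_list \<rho> = sum_list \<mu> + n * t} = hook_level t \<mu> n"
    using core_of_eq_iff[OF assms] hook_ge_is_partition by (auto simp: hook_level_def)
  then show ?thesis using sum_hook_level_square[OF assms, of n] by (simp only: mult.assoc)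
qed

end
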